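(* Let $X$ be a compact metrizable space, $\sigma$ a homeomorphism of $X$, and $\Sigma=(X,\sigma)$. Let $\pi=\pi_{(\mu,\mathcal{H},W)}$ be an irreducible representation of $C^*(\Sigma)$ and suppose that $\mu$ is non-atomic. Assume that for any $\epsilon>0$ there is a measurable subset $A$ of $X$ such that $0<\sup_{k\in\mathbb{Z}}\mu(\sigma^k(A))<\epsilon$ (which follows if $\mu$ is $\sigma$-invariant, or if $\sigma$ preserves a metric on $X$ which induces the topology of $X$). Then the restriction $\pi|_{\ell^1(\Sigma)}$ is not algebraically irreducible.
   Context: Let $\alpha(f)=f\circ\sigma^{-1}$ on $C(X)$. $\ell^1(\Sigma)=\ell^1(\mathbb{Z},C(X))$ is the Banach $*$-algebra with product $(fg)(n)=\sum_k f(k)\alpha^k(g(n-k))$, involution $f^*(n)=\alpha^n(f(-n))^*$ and norm $\|f\|_1=\sum_n\|f(n)\|$; $C^*(\Sigma)$ is its enveloping $C^*$-algebra. $\delta_n(k)=\delta_{n,k}$, and $f\in C(X)$ is identified with $f\delta_0$. The representation $\pi_{(\mu,\mathcal{H},W)}$: $\mu$ is an ergodic $\sigma$-quasi-invariant Borel probability measure on $X$ ($\mu$ and $\mu\sigma^{-1}$ have the same null sets; $\sigma$-invariant Borel sets have measure $0$ or $1$), $\mathcal{H}$ is a Hilbert space, $V$ is the unitary on $L^2(X,\mu)$ given by $(V\xi)(x)=\left(\frac{d\mu\sigma^{-1}}{d\mu}(x)\right)^{1/2}\xi(\sigma^{-1}(x))$ with $\mu\sigma^{-1}(A)=\mu(\sigma^{-1}(A))$,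 and $W$ is a unitary in the von Neumann algebra $L^\infty(X,\mu)\otimes\mathcal{B}(\mathcal{H})$ such that the fixed point algebra of $\mathrm{Ad}(W(V\otimes1))$ on $L^\infty(X,\mu)\otimes\mathcal{B}(\mathcal{H})$ is $\mathbb{C}1$. Then $\pi_{(\mu,\mathcal{H},W)}$ is the irreducible representation of $C^*(\Sigma)$ on $L^2(X,\mu)\otimes\mathcal{H}$ with $\pi(f)=M_f\otimes1$ for $f\in C(X)$ ($M_f$ is multiplication by $f$) and $\pi(\delta_1)=W(V\otimes1)$. A representation on a vector space is algebraically irreducible if the only invariant linear subspaces (not necessarily closed) are $0$ and the whole space. *)

theory Defs
  imports "HOL-Analysis.Analysis" "HOL-Probability.Probability_Measure"
begin

section \<open>Complex Hilbert spaces and unital C*-algebras\<close>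

class complex_normed_vector = real_normed_vector +
  fixes scaleC :: "complex \<Rightarrow> 'a \<Rightarrow> 'a"
  assumes scaleC_of_real: "scaleC (complex_of_real r) x = scaleR r x"
    and scaleC_add_right: "scaleC c (x + y) = scaleC c x + scaleC c y"
    and scaleC_add_left: "scaleC (c + d) x = scaleC c x + scaleC d x"
    and scaleC_scaleC: "scaleC c (scaleC d x) = scaleC (c * d) x"
    and norm_scaleC: "norm (scaleC c x) = cmod c * norm x"

text \<open>The inner product is linear in the first argument.\<close>

class hilbert_space = complex_normed_vector + complete_space +
  fixes cinner :: "'a \<Rightarrow> 'a \<Rightarrow> complex"
  assumes cinner_commute: "cinner x y = cnj (cinner y x)"
    and cinner_add_left: "cinner (x + y) z = cinner x z + cinner y z"
    and cinner_scaleC_left: "cinner (scaleC c x) y = c * cinner x y"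
    and norm_eq_sqrt_cinner: "norm x = sqrt (Re (cinner x x))"

class unital_cstar_algebra = complex_normed_vector + real_normed_algebra_1 + complete_space +
  fixes cstar :: "'a \<Rightarrow> 'a"
  assumes scaleC_mult_left: "scaleC c x * y = scaleC c (x * y)"
    and scaleC_mult_right: "x * scaleC c y = scaleC c (x * y)"
    and cstar_add: "cstar (x + y) = cstar x + cstar y"
    and cstar_scaleC: "cstar (scaleC c x) = scaleC (cnj c) (cstar x)"
    and cstar_mult: "cstar (x * y) = cstar y * cstar x"
    and cstar_cstar: "cstar (cstar x) = x"
    and cstar_identity: "norm (cstar x * x) = (norm x)\<^sup>2"

definition csubspace :: "'a::complex_normed_vector set \<Rightarrow> bool" where
  "csubspace S \<longleftrightarrow> 0 \<in> S \<and> (\<forall>x\<in>S. \<forall>y\<in>S. x + y \<in> S) \<and> (\<forall>c. \<forall>x\<in>S. scaleC c x \<in> S)"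

definition bounded_clinear :: "('a::complex_normed_vector \<Rightarrow> 'b::complex_normed_vector) \<Rightarrow> bool" where
  "bounded_clinear T \<longleftrightarrow> bounded_linear T \<and> (\<forall>c x. T (scaleC c x) = scaleC c (T x))"

definition unitary_op :: "('a::hilbert_space \<Rightarrow> 'a) \<Rightarrow> bool" where
  "unitary_op U \<longleftrightarrow> bounded_clinear U \<and> surj U \<and> (\<forall>x y. cinner (U x) (U y) = cinner x y)"

definition commutant :: "('a::hilbert_space \<Rightarrow> 'a) set \<Rightarrow> ('a \<Rightarrow> 'a) set" where
  "commutant \<S> = {R. bounded_clinear R \<and> (\<forall>T\<in>\<S>. R \<circ> T = T \<circ> R)}"

text \<open>\<open>Ad(U)(R) = U R U\<^sup>*\<close>, with \<open>U\<^sup>* = U\<^sup>-\<^sup>1\<close> for unitary \<open>U\<close>.\<close>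

definition Ad :: "('a \<Rightarrow> 'a) \<Rightarrow> ('a \<Rightarrow> 'a) \<Rightarrow> ('a \<Rightarrow> 'a)" where
  "Ad U R = U \<circ> R \<circ> inv U"

definition algebraically_irreducible :: "('a::hilbert_space \<Rightarrow> 'a) set \<Rightarrow> bool" where
  "algebraically_irreducible \<S> \<longleftrightarrow>
     (\<forall>S. csubspace S \<and> (\<forall>T\<in>\<S>. T ` S \<subseteq> S) \<longrightarrow> S = {0} \<or> S = UNIV)"

text \<open>As usual, the zero representation is not counted as (topologically) irreducible.\<close>

definition topologically_irreducible :: "('a::hilbert_space \<Rightarrow> 'a) set \<Rightarrow> bool" where
  "topologically_irreducible \<S> \<longleftrightarrow> (UNIV :: 'a set) \<noteq> {0} \<and>
     (\<forall>S. csubspace S \<and> closed S \<and> (\<forall>T\<in>\<S>. T ` S \<subseteq> S) \<longrightarrow> S = {0} \<or> S = UNIV)"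

definition star_representation :: "('c::unital_cstar_algebra \<Rightarrow> 'k::hilbert_space \<Rightarrow> 'k) \<Rightarrow> bool" where
  "star_representation \<pi> \<longleftrightarrow>
     (\<forall>a. bounded_clinear (\<pi> a)) \<and>
     (\<forall>a b x. \<pi> (a + b) x = \<pi> a x + \<pi> b x) \<and>
     (\<forall>c a x. \<pi> (scaleC c a) x = scaleC c (\<pi> a x)) \<and>
     (\<forall>a b. \<pi> (a * b) = \<pi> a \<circ> \<pi> b) \<and>
     (\<forall>a x y. cinner (\<pi> a x) y = cinner x (\<pi> (cstar a) y))"


section \<open>The Banach *-algebra of a dynamical system and its enveloping C*-algebra\<close>

definition zpow :: "('a \<Rightarrow> 'a) \<Rightarrow> int \<Rightarrow> 'a \<Rightarrow> 'a" where
  "zpow g k = (if 0 \<le> k then g ^^ nat k else inv g ^^ nat (- k))"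

text \<open>For compact \<open>X\<close> the library type \<open>X \<Rightarrow>\<^sub>C complex\<close> of bounded continuous functions, with its
  supremum norm, is \<open>C(X)\<close>.\<close>

setup_lifting type_definition_bcontfun

lift_definition cmult :: "('x::topological_space \<Rightarrow>\<^sub>C complex) \<Rightarrow> ('x \<Rightarrow>\<^sub>C complex) \<Rightarrow> ('x \<Rightarrow>\<^sub>C complex)"
  is "\<lambda>f g x. f x * g x"
proof -
  fix f g :: "'x \<Rightarrow> complex"
  assume f: "f \<in> bcontfun" and g: "g \<in> bcontfun"
  obtain B where B: "\<And>x. cmod (f x) \<le> B"
    using f by (auto simp: bcontfun_def bounded_iff)
  obtain C where C: "\<And>x. cmod (g x) \<le> C"
    using g by (auto simp: bcontfun_def bounded_iff)
  have "cmod (f x * g x) \<le> B * C" for x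
    unfolding norm_mult by (rule mult_mono) (use B C order_trans[OF norm_ge_zero B] in auto)
  then have "bounded (range (\<lambda>x. f x * g x))"
    by (auto simp: bounded_iff)
  with f g show "(\<lambda>x. f x * g x) \<in> bcontfun"
    by (auto simp: bcontfun_def intro!: continuous_intros)
qed

lift_definition ccnj :: "('x::topological_space \<Rightarrow>\<^sub>C complex) \<Rightarrow> ('x \<Rightarrow>\<^sub>C complex)"
  is "\<lambda>f x. cnj (f x)"
  by (auto simp: bcontfun_def bounded_iff intro!: continuous_intros)

text \<open>\<open>\<alpha>(f) = f \<circ> \<sigma>\<^sup>-\<^sup>1\<close>; meaningful when \<open>\<sigma>\<close> is a homeomorphism.\<close>

definition alpha :: "('x::topological_space \<Rightarrow> 'x) \<Rightarrow> ('x \<Rightarrow>\<^sub>C complex) \<Rightarrow> ('x \<Rightarrow>\<^sub>C complex)" where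
  "alpha \<sigma> f = Bcontfun (\<lambda>x. f (inv \<sigma> x))"

definition ell1 :: "(int \<Rightarrow> ('x::topological_space \<Rightarrow>\<^sub>C complex)) set" where
  "ell1 = {a. (\<lambda>n. norm (a n)) summable_on UNIV}"

definition l1_norm :: "(int \<Rightarrow> ('x::topological_space \<Rightarrow>\<^sub>C complex)) \<Rightarrow> real" where
  "l1_norm a = (\<Sum>\<^sub>\<infinity>n. norm (a n))"

definition l1_add :: "(int \<Rightarrow> ('x::topological_space \<Rightarrow>\<^sub>C complex)) \<Rightarrow> (int \<Rightarrow> ('x \<Rightarrow>\<^sub>C complex))
    \<Rightarrow> (int \<Rightarrow> ('x \<Rightarrow>\<^sub>C complex))" where
  "l1_add a b = (\<lambda>n. a n + b n)"

definition l1_scale :: "complex \<Rightarrow> (int \<Rightarrow> ('x::topological_space \<Rightarrow>\<^sub>C complex))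
    \<Rightarrow> (int \<Rightarrow> ('x \<Rightarrow>\<^sub>C complex))" where
  "l1_scale c a = (\<lambda>n. cmult (const_bcontfun c) (a n))"

definition l1_mult :: "('x::topological_space \<Rightarrow> 'x) \<Rightarrow> (int \<Rightarrow> ('x \<Rightarrow>\<^sub>C complex))
    \<Rightarrow> (int \<Rightarrow> ('x \<Rightarrow>\<^sub>C complex)) \<Rightarrow> (int \<Rightarrow> ('x \<Rightarrow>\<^sub>C complex))" where
  "l1_mult \<sigma> a b = (\<lambda>n. \<Sum>\<^sub>\<infinity>k. cmult (a k) (zpow (alpha \<sigma>) k (b (n - k))))"

definition l1_star :: "('x::topological_space \<Rightarrow> 'x) \<Rightarrow> (int \<Rightarrow> ('x \<Rightarrow>\<^sub>C complex))
    \<Rightarrow> (int \<Rightarrow> ('x \<Rightarrow>\<^sub>C complex))" where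
  "l1_star \<sigma> a = (\<lambda>n. zpow (alpha \<sigma>) n (ccnj (a (- n))))"

text \<open>\<open>l1_single n f\<close> is \<open>f \<delta>\<^sub>n\<close>.\<close>

definition l1_single :: "int \<Rightarrow> ('x::topological_space \<Rightarrow>\<^sub>C complex) \<Rightarrow> (int \<Rightarrow> ('x \<Rightarrow>\<^sub>C complex))" where
  "l1_single n f = (\<lambda>k. if k = n then f else 0)"

definition l1_delta :: "int \<Rightarrow> (int \<Rightarrow> ('x::topological_space \<Rightarrow>\<^sub>C complex))" where
  "l1_delta n = l1_single n (const_bcontfun 1)"

definition l1_cstar_seminorm ::
    "('x::topological_space \<Rightarrow> 'x) \<Rightarrow> ((int \<Rightarrow> ('x \<Rightarrow>\<^sub>C complex)) \<Rightarrow> real) \<Rightarrow> bool" where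
  "l1_cstar_seminorm \<sigma> p \<longleftrightarrow>
     (\<forall>a\<in>ell1. 0 \<le> p a \<and> p a \<le> l1_norm a) \<and>
     (\<forall>a\<in>ell1. \<forall>b\<in>ell1. p (l1_add a b) \<le> p a + p b) \<and>
     (\<forall>c. \<forall>a\<in>ell1. p (l1_scale c a) = cmod c * p a) \<and>
     (\<forall>a\<in>ell1. \<forall>b\<in>ell1. p (l1_mult \<sigma> a b) \<le> p a * p b) \<and>
     (\<forall>a\<in>ell1. p (l1_mult \<sigma> (l1_star \<sigma> a) a) = (p a)\<^sup>2)"

text \<open>\<open>\<iota>\<close> exhibits \<open>'c\<close> as the enveloping C*-algebra of \<open>\<ell>\<^sup>1(\<Sigma>)\<close>, i.e. the completion in the
  seminorm \<open>a \<mapsto> sup \<parallel>\<rho>(a)\<parallel>\<close> over all *-representations \<open>\<rho>\<close>. The seminorms \<open>a \<mapsto> \<parallel>\<rho>(a)\<parallel>\<close> are precisely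
  the C*-seminorms below the \<open>\<ell>\<^sup>1\<close>-norm (by Gelfand-Naimark, and since *-representations of a Banach
  *-algebra with isometric involution are contractive); the supremum is taken over these, as
  one cannot quantify over all Hilbert space types inside a formula.\<close>

definition enveloping_cstar_algebra ::
    "('x::topological_space \<Rightarrow> 'x) \<Rightarrow> ((int \<Rightarrow> ('x \<Rightarrow>\<^sub>C complex)) \<Rightarrow> 'c::unital_cstar_algebra) \<Rightarrow> bool" where
  "enveloping_cstar_algebra \<sigma> \<iota> \<longleftrightarrow>
     (\<forall>a\<in>ell1. \<forall>b\<in>ell1. \<iota> (l1_add a b) = \<iota> a + \<iota> b) \<and>
     (\<forall>c. \<forall>a\<in>ell1. \<iota> (l1_scale c a) = scaleC c (\<iota> a)) \<and>
     (\<forall>a\<in>ell1. \<forall>b\<in>ell1. \<iota> (l1_mult \<sigma> a b) = \<iota> a * \<iota> b) \<and>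
     (\<forall>a\<in>ell1. \<iota> (l1_star \<sigma> a) = cstar (\<iota> a)) \<and>
     (\<forall>a\<in>ell1. norm (\<iota> a) = (SUP p\<in>{p. l1_cstar_seminorm \<sigma> p}. p a)) \<and>
     closure (\<iota> ` ell1) = UNIV"


section \<open>Measures\<close>

definition quasi_invariant :: "('x::topological_space \<Rightarrow> 'x) \<Rightarrow> 'x measure \<Rightarrow> bool" where
  "quasi_invariant \<sigma> \<mu> \<longleftrightarrow>
     (\<forall>A\<in>sets borel. emeasure \<mu> (\<sigma> -` A) = 0 \<longleftrightarrow> emeasure \<mu> A = 0)"

definition ergodic :: "('x::topological_space \<Rightarrow> 'x) \<Rightarrow> 'x measure \<Rightarrow> bool" where
  "ergodic \<sigma> \<mu> \<longleftrightarrow>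
     (\<forall>A\<in>sets borel. \<sigma> -` A = A \<longrightarrow> measure \<mu> A = 0 \<or> measure \<mu> A = 1)"

definition non_atomic :: "'x measure \<Rightarrow> bool" where
  "non_atomic \<mu> \<longleftrightarrow>
     \<not> (\<exists>A\<in>sets \<mu>. 0 < emeasure \<mu> A \<and>
          (\<forall>B\<in>sets \<mu>. B \<subseteq> A \<longrightarrow> emeasure \<mu> B = 0 \<or> emeasure \<mu> B = emeasure \<mu> A))"

definition small_translates :: "('x::topological_space \<Rightarrow> 'x) \<Rightarrow> 'x measure \<Rightarrow> bool" where
  "small_translates \<sigma> \<mu> \<longleftrightarrow>
     (\<forall>\<epsilon>>0. \<exists>A\<in>sets borel. 0 < (SUP k::int. measure \<mu> (zpow \<sigma> k ` A)) \<and>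
                          (SUP k::int. measure \<mu> (zpow \<sigma> k ` A)) < \<epsilon>)"

definition measure_invariant :: "('x::topological_space \<Rightarrow> 'x) \<Rightarrow> 'x measure \<Rightarrow> bool" where
  "measure_invariant \<sigma> \<mu> \<longleftrightarrow> (\<forall>A\<in>sets borel. measure \<mu> (\<sigma> -` A) = measure \<mu> A)"

definition preserves_compatible_metric :: "('x::topological_space \<Rightarrow> 'x) \<Rightarrow> bool" where
  "preserves_compatible_metric \<sigma> \<longleftrightarrow>
     (\<exists>d. Metric_space UNIV d \<and> Metric_space.mtopology UNIV d = euclidean \<and>
          (\<forall>x y. d (\<sigma> x) (\<sigma> y) = d x y))"


section \<open>\<open>L\<^sup>2\<close>-spaces, tensor products and their operators\<close>

definition L2_fun :: "'x measure \<Rightarrow> ('x \<Rightarrow> complex) set" where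
  "L2_fun \<mu> = {\<xi>. \<xi> \<in> borel_measurable \<mu> \<and> integrable \<mu> (\<lambda>x. (cmod (\<xi> x))\<^sup>2)}"

definition Linf_fun :: "'x measure \<Rightarrow> ('x \<Rightarrow> complex) set" where
  "Linf_fun \<mu> = {f. f \<in> borel_measurable \<mu> \<and> (\<exists>C. AE x in \<mu>. cmod (f x) \<le> C)}"

text \<open>Since the space \<open>L\<^sup>2(X,\<mu>)\<close> depends on the term \<open>\<mu>\<close>, it cannot be formed as a type. It is given by a
  Hilbert space \<open>'l\<close> together with the map \<open>cls\<close> sending a square-integrable function to its
  class. The inner product formula forces \<open>cls \<xi> = cls \<eta>\<close> to mean \<open>\<xi> = \<eta>\<close> almost everywhere.\<close>

definition L2_space :: "'x measure \<Rightarrow> (('x \<Rightarrow> complex) \<Rightarrow> 'l::hilbert_space) \<Rightarrow> bool" where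
  "L2_space \<mu> cls \<longleftrightarrow>
     (\<forall>\<xi>\<in>L2_fun \<mu>. \<forall>\<eta>\<in>L2_fun \<mu>. cls (\<lambda>x. \<xi> x + \<eta> x) = cls \<xi> + cls \<eta>) \<and>
     (\<forall>c. \<forall>\<xi>\<in>L2_fun \<mu>. cls (\<lambda>x. c * \<xi> x) = scaleC c (cls \<xi>)) \<and>
     (\<forall>\<xi>\<in>L2_fun \<mu>. \<forall>\<eta>\<in>L2_fun \<mu>. cinner (cls \<xi>) (cls \<eta>) = (\<integral>x. \<xi> x * cnj (\<eta> x) \<partial>\<mu>)) \<and>
     cls ` L2_fun \<mu> = UNIV"

text \<open>The operator on \<open>L\<^sup>2(X,\<mu>)\<close> induced by an operation on representatives.\<close>

definition L2_lift :: "'x measure \<Rightarrow> (('x \<Rightarrow> complex) \<Rightarrow> 'l)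
    \<Rightarrow> (('x \<Rightarrow> complex) \<Rightarrow> ('x \<Rightarrow> complex)) \<Rightarrow> 'l \<Rightarrow> 'l" where
  "L2_lift \<mu> cls F v = cls (F (inv_into (L2_fun \<mu>) cls v))"

definition mult_op :: "'x measure \<Rightarrow> (('x \<Rightarrow> complex) \<Rightarrow> 'l) \<Rightarrow> ('x \<Rightarrow> complex) \<Rightarrow> 'l \<Rightarrow> 'l" where
  "mult_op \<mu> cls f = L2_lift \<mu> cls (\<lambda>\<xi> x. f x * \<xi> x)"

text \<open>The unitary \<open>V\<close>. Note that \<open>distr \<mu> borel \<sigma>\<close> is \<open>\<mu>\<sigma>\<^sup>-\<^sup>1\<close> and \<open>RN_deriv \<mu> N\<close> is \<open>dN/d\<mu>\<close>.\<close>

definition translation_op :: "('x::topological_space \<Rightarrow> 'x) \<Rightarrow> 'x measure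
    \<Rightarrow> (('x \<Rightarrow> complex) \<Rightarrow> 'l) \<Rightarrow> 'l \<Rightarrow> 'l" where
  "translation_op \<sigma> \<mu> cls = L2_lift \<mu> cls
     (\<lambda>\<xi> x. complex_of_real (sqrt (enn2real (RN_deriv \<mu> (distr \<mu> borel \<sigma>) x))) * \<xi> (inv \<sigma> x))"

text \<open>\<open>'k\<close> is the Hilbert space tensor product of \<open>'l\<close> and \<open>'h\<close>, with elementary tensors
  \<open>tens \<xi> h\<close>. These are closed under complex scalars, so their real span is their complex span.\<close>

definition hilbert_tensor ::
    "('l::hilbert_space \<Rightarrow> 'h::hilbert_space \<Rightarrow> 'k::hilbert_space) \<Rightarrow> bool" where
  "hilbert_tensor tens \<longleftrightarrow>
     (\<forall>h. bounded_clinear (\<lambda>\<xi>. tens \<xi> h)) \<and>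
     (\<forall>\<xi>. bounded_clinear (tens \<xi>)) \<and>
     (\<forall>\<xi> \<eta> h g. cinner (tens \<xi> h) (tens \<eta> g) = cinner \<xi> \<eta> * cinner h g) \<and>
     closure (span {tens \<xi> h |\<xi> h. True}) = UNIV"

text \<open>\<open>R = S \<otimes> T\<close>; by density such an \<open>R\<close> is unique.\<close>

definition is_tensor_op ::
    "('l::hilbert_space \<Rightarrow> 'h::hilbert_space \<Rightarrow> 'k::hilbert_space)
     \<Rightarrow> ('l \<Rightarrow> 'l) \<Rightarrow> ('h \<Rightarrow> 'h) \<Rightarrow> ('k \<Rightarrow> 'k) \<Rightarrow> bool" where
  "is_tensor_op tens S T R \<longleftrightarrow>
     bounded_clinear R \<and> (\<forall>\<xi> h. R (tens \<xi> h) = tens (S \<xi>) (T h))"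

text \<open>The von Neumann algebra tensor product \<open>L\<^sup>\<infinity>(X,\<mu>) \<otimes> B(H)\<close>: the von Neumann algebra
  generated by (i.e. the double commutant of) the selfadjoint set of all \<open>M\<^sub>f \<otimes> T\<close>.\<close>

definition Linf_tensor_BH :: "'x measure \<Rightarrow> (('x \<Rightarrow> complex) \<Rightarrow> 'l::hilbert_space)
    \<Rightarrow> ('l \<Rightarrow> 'h::hilbert_space \<Rightarrow> 'k::hilbert_space) \<Rightarrow> ('k \<Rightarrow> 'k) set" where
  "Linf_tensor_BH \<mu> cls tens = commutant (commutant
     {R. \<exists>f\<in>Linf_fun \<mu>. \<exists>T. bounded_clinear T \<and> is_tensor_op tens (mult_op \<mu> cls f) T R})"

end

(* Write M_f for the image of f in C(X), U for the image of delta_1 and s(K) = sup_k mu(sigma^k(K)).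
   For closed K let N_K(x) be the infimum of |M_f x| over the continuous f with |f| <= 1 and f = 1 on
   K. Each N_K is subadditive, N_K(M_f x) <= |f| N_K(x), and the covariance U M_f = M_{alpha(f)} U gives
   N_K(U^n x) <= N_{sigma^-n(K)}(x). Since s is sigma-invariant and elements of l^1 act by norm
   convergent series of operators M_f U^n, the vectors x with N_K(x) = O(s(K)^{1/2}) form an invariant
   subspace. It contains 1 (x) h because N_K(1 (x) h) <= mu(K)^{1/2} |h|, but it is proper: a vector
   whose mass on closed sets K_j with s(K_j) -> 0 decays slowly is not in it. *)
theory Submission
  imports Defs
begin

section \<open>Hilbert spaces and representations of C*-algebras\<close>

text \<open>\<open>small_translates\<close> provides Borel sets, but only continuous functions act
  through \<pi>, and in general no continuous function cuts a vector down to a set exactly; the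
  infima over cut-offs replace the missing projections. A continuous function that is 1 on a set is
  1 on its closure, hence the restriction to closed sets and the need for inner regularity, derived
  here from a metric taken from metrizability. A second obstacle is that a star representation is
  assumed bounded operator by operator: contractivity of \<pi> has to be proved before l^1 series
  can be mapped term by term. The estimate is tied to the l^1 norm: a bound c common to all U^n x
  gives |a|_1 * c for the image of x under a, whereas the norm of the enveloping algebra does not
  control the sum of the |a(n)|. The exponent 1/2 is that of the L^2 norm mu(K)^{1/2} of an
  indicator. A vector outside exists because sets with s(K_j) < 16^-j make the bound decay like
  4^-j, while its components over K_j decay no faster than 2^-j.\<close>

instance hilbert_space \<subseteq> banach ..

text \<open>The class \<open>hilbert_space\<close> states no positivity axiom. It is hidden in
  \<open>norm_eq_sqrt_cinner\<close>: \<open>sqrt\<close> is odd in HOL, so a nonnegative norm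
  forces a nonnegative argument.\<close>

lemma Re_cinner_self: "Re (cinner x x) = (norm x)\<^sup>2"
proof -
  have "0 \<le> sqrt (Re (cinner x x))"
    using norm_ge_zero[of x] by (simp add: norm_eq_sqrt_cinner)
  then show ?thesis by (simp add: norm_eq_sqrt_cinner)
qed

lemma cinner_add_right: "cinner x (y + z) = cinner x y + cinner x z"
  by (metis cinner_add_left cinner_commute complex_cnj_add)

lemma cinner_scaleC_right: "cinner x (scaleC c y) = cnj c * cinner x y"
  by (metis cinner_commute cinner_scaleC_left complex_cnj_mult)

lemma Re_cinner_commute: "Re (cinner x y) = Re (cinner y x)"
  by (subst cinner_commute) simp

lemma Im_cinner_self: "Im (cinner x x) = 0"
  using arg_cong[OF cinner_commute[of x x], of Im] by simp

text \<open>The usual order is reversed: the triangle inequality is already an axiom, and expanding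
  the square of norm (x + y) turns it into Cauchy-Schwarz for the real part.\<close>

lemma Re_cinner_le: "Re (cinner x y) \<le> norm x * norm y"
proof -
  have "(norm (x + y))\<^sup>2 = (norm x)\<^sup>2 + (norm y)\<^sup>2 + 2 * Re (cinner x y)"
    unfolding Re_cinner_self[symmetric]
    by (simp add: cinner_add_left cinner_add_right Re_cinner_commute[of y x])
  moreover have "(norm (x + y))\<^sup>2 \<le> (norm x + norm y)\<^sup>2"
    by (intro power_mono norm_triangle_ineq) simp
  ultimately show ?thesis by (simp add: power2_eq_square algebra_simps)
qed

text \<open>Needed to take inner products term by term in the series that defines a vector outside
  the subspace.\<close>

lemma bounded_linear_Re_cinner: "bounded_linear (\<lambda>x. Re (cinner x y))"
proof (rule bounded_linear_intro)
  fix x z :: 'a and r :: real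
  show "Re (cinner (x + z) y) = Re (cinner x y) + Re (cinner z y)"
    by (simp add: cinner_add_left)
  show "Re (cinner (r *\<^sub>R x) y) = r *\<^sub>R Re (cinner x y)"
    by (simp add: scaleC_of_real[symmetric] cinner_scaleC_left)
  show "norm (Re (cinner x y)) \<le> norm x * norm y"
    using Re_cinner_le[of x y] Re_cinner_le[of "scaleC (-1) x" y]
    by (simp add: cinner_scaleC_left norm_scaleC)
qed

section \<open>Contractivity of star representations\<close>

lemma norm_cstar: "norm (cstar x) = norm (x :: 'a :: unital_cstar_algebra)"
proof -
  have le: "norm y \<le> norm (cstar y)" for y :: 'a
  proof (cases "y = 0")
    case False
    have "norm y * norm y \<le> norm (cstar y) * norm y"
      using norm_mult_ineq[of "cstar y" y] by (simp add: cstar_identity power2_eq_square)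
    with False show ?thesis by simp
  qed simp
  from le[of x] le[of "cstar x"] show ?thesis by (simp add: cstar_cstar)
qed

lemma cstar_one: "cstar (1 :: 'a :: unital_cstar_algebra) = 1"
  by (metis cstar_cstar cstar_mult mult_1 mult_1_right)

lemma cstar_scaleR: "cstar (r *\<^sub>R x) = r *\<^sub>R cstar (x :: 'a :: unital_cstar_algebra)"
  by (simp add: scaleC_of_real[symmetric] cstar_scaleC)

lemma cstar_diff: "cstar (x - y) = cstar x - cstar (y :: 'a :: unital_cstar_algebra)"
  by (metis add_diff_cancel_right' cstar_add diff_add_cancel)

lemma bounded_linear_cstar: "bounded_linear (cstar :: 'a \<Rightarrow> 'a :: unital_cstar_algebra)"
  by (rule bounded_linear_intro[where K = 1]) (simp_all add: cstar_add cstar_scaleR norm_cstar)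

text \<open>The equation \<open>1 - b = (1 - d)\<^sup>2\<close> means \<open>d = (b + d\<^sup>2) / 2\<close>; the right-hand side is a contraction of the
  selfadjoint part of the ball of radius \<open>1 - sqrt (1 - \<parallel>b\<parallel>)\<close>.\<close>

lemma selfadjoint_sqrt_one_minus:
  fixes b :: "'a :: unital_cstar_algebra"
  assumes b: "cstar b = b" "norm b < 1"
  obtains d where "cstar d = d" "1 - b = (1 - d) * (1 - d)"
proof -
  define r where "r = 1 - sqrt (1 - norm b)"
  define B where "B = {d :: 'a. cstar d = d \<and> norm d \<le> r}"
  define F where "F = (\<lambda>d :: 'a. (1/2) *\<^sub>R (b + d * d))"
  \<comment> \<open>r is the smaller root of t = (norm b + t * t) / 2, so \<open>F\<close> maps the
    ball of radius r into itself; since d * d - e * e = d * (d - e) + (d - e) * e, it is also a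
    Lipschitz constant.\<close>
  have r: "0 \<le> r" "r < 1" "(norm b + r * r) / 2 = r"
  proof -
    have "(1 - r) * (1 - r) = 1 - norm b" using b(2) by (simp add: r_def)
    then show "(norm b + r * r) / 2 = r" by (simp add: algebra_simps)
    show "0 \<le> r" "r < 1" using b(2) by (simp_all add: r_def)
  qed
  have "closed B"
    unfolding B_def
    by (intro closed_Collect_conj closed_Collect_eq closed_Collect_le continuous_intros
        linear_continuous_on bounded_linear_cstar)
  then have "complete B" by (simp add: complete_eq_closed)
  moreover have "B \<noteq> {}"
  proof -
    have "0 \<in> B" using r(1) cstar_scaleR[of 0 "0::'a"] by (simp add: B_def)
    then show ?thesis by blast
  qed
  moreover have "F ` B \<subseteq> B"
  proof safe
    fix d assume d: "d \<in> B"
    have "norm (b + d * d) \<le> norm b + r * r"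
      using d norm_mult_ineq[of d d] mult_mono[of "norm d" r "norm d" r] r(1)
        norm_triangle_ineq[of b "d * d"]
      by (auto simp: B_def)
    with d b r show "F d \<in> B"
      by (simp add: B_def F_def cstar_scaleR cstar_add cstar_mult)
  qed
  moreover have "\<forall>d\<in>B. \<forall>e\<in>B. dist (F d) (F e) \<le> r * dist d e"
  proof (intro ballI)
    fix d e assume d: "d \<in> B" and e: "e \<in> B"
    have "F d - F e = (1/2) *\<^sub>R (d * (d - e) + (d - e) * e)"
      by (simp add: F_def algebra_simps)
    moreover have "norm (d * (d - e)) \<le> r * norm (d - e)"
      using norm_mult_ineq[of d "d - e"] d mult_right_mono[of "norm d" r "norm (d - e)"]
      by (auto simp: B_def)
    moreover have "norm ((d - e) * e) \<le> r * norm (d - e)"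
      using norm_mult_ineq[of "d - e" e] e mult_right_mono[of "norm e" r "norm (d - e)"]
      by (auto simp: B_def mult.commute)
    ultimately show "dist (F d) (F e) \<le> r * dist d e"
      using norm_triangle_ineq[of "d * (d - e)" "(d - e) * e"] by (simp add: dist_norm)
  qed
  ultimately obtain d where d: "d \<in> B" "F d = d"
    using Banach_fix[of B r F] r by metis
  have "b + d * d = d + d"
    using d(2) unfolding F_def by (metis scaleR_half_double scaleR_right_distrib)
  then have "1 - b = (1 - d) * (1 - d)" by (simp add: algebra_simps)
  with d(1) show ?thesis using that by (auto simp: B_def)
qed

text \<open>For t > norm c the element 1 - (cstar c * c) / t^2 is the square of a selfadjoint one,
  so its image is positive and norm (\<pi> c x) \<le> t * norm x; then t tends to norm c. The strict
  inequality is what makes the square root available.\<close>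

lemma star_representation_norm_le:
  assumes rep: "star_representation \<pi>"
  shows "norm (\<pi> c x) \<le> norm c * norm x"
proof -
  have add: "\<pi> (a + b) y = \<pi> a y + \<pi> b y" and scale: "\<pi> (scaleC t a) y = scaleC t (\<pi> a y)"
    and mult: "\<pi> (a * b) y = \<pi> a (\<pi> b y)" and star: "cinner (\<pi> a y) z = cinner y (\<pi> (cstar a) z)"
    for a b t y z
    using rep by (simp_all add: star_representation_def)
  have norm_sq: "(norm (\<pi> a y))\<^sup>2 = Re (cinner y (\<pi> (cstar a * a) y))" for a y
    by (simp add: Re_cinner_self[symmetric] mult star)
  \<comment> \<open>\<pi> is not assumed unital, so \<pi> 1 is only a selfadjoint idempotent; it is
    a contraction because norm (\<pi> 1 x)^2 = Re (cinner x (\<pi> 1 x)).\<close>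
  have one: "Re (cinner x (\<pi> 1 x)) \<le> (norm x)\<^sup>2"
  proof -
    have "(norm (\<pi> 1 x))\<^sup>2 = Re (cinner x (\<pi> 1 x))" using norm_sq[of 1 x] by (simp add: cstar_one)
    with Re_cinner_le[of x "\<pi> 1 x"] have *: "norm (\<pi> 1 x) * norm (\<pi> 1 x) \<le> norm x * norm (\<pi> 1 x)"
      by (simp add: power2_eq_square)
    then have "norm (\<pi> 1 x) \<le> norm x" by (cases "\<pi> 1 x = 0") simp_all
    with Re_cinner_le[of x "\<pi> 1 x"] show ?thesis
      by (smt (verit) mult_left_mono norm_ge_zero power2_eq_square)
  qed
  have "norm (\<pi> c x) \<le> t * norm x" if t: "norm c < t" for t
  proof -
    have t0: "0 < t" using t norm_ge_zero[of c] by linarith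
    define b where "b = (1 / t\<^sup>2) *\<^sub>R (cstar c * c)"
    have "cstar b = b" by (simp add: b_def cstar_scaleR cstar_mult cstar_cstar)
    moreover have "norm b < 1"
      using t t0 by (simp add: b_def cstar_identity power2_eq_square mult_strict_mono field_simps)
    ultimately obtain d where d: "cstar d = d" "1 - b = (1 - d) * (1 - d)"
      by (rule selfadjoint_sqrt_one_minus)
    have "0 \<le> Re (cinner x (\<pi> (1 - b) x))"
      using norm_sq[of "1 - d" x] d by (simp add: cstar_diff cstar_one) (metis zero_le_power2)
    moreover have "\<pi> 1 x = \<pi> (1 - b) x + \<pi> b x" using add[of "1 - b" b x] by simp
    ultimately have "Re (cinner x (\<pi> b x)) \<le> (norm x)\<^sup>2"
      using one by (simp add: cinner_add_right)
    moreover have "\<pi> b x = scaleC (complex_of_real (1 / t\<^sup>2)) (\<pi> (cstar c * c) x)"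
      unfolding b_def by (metis scale scaleC_of_real)
    ultimately have "(norm (\<pi> c x))\<^sup>2 / t\<^sup>2 \<le> (norm x)\<^sup>2"
      by (simp add: cinner_scaleC_right norm_sq)
    then have "(norm (\<pi> c x))\<^sup>2 \<le> (t * norm x)\<^sup>2"
      using t0 by (simp add: field_simps)
    then show ?thesis using t0 by (simp add: power2_le_iff_abs_le)
  qed
  then have *: "norm (\<pi> c x) \<le> (norm c + e) * norm x" if "0 < e" for e
    using that by simp
  show ?thesis
  proof (rule field_le_epsilon)
    fix e :: real assume e: "0 < e"
    \<comment> \<open>The summand 1 in the denominator covers x = 0.\<close>
    have "norm (\<pi> c x) \<le> (norm c + e / (norm x + 1)) * norm x"
      by (rule *) (use e norm_ge_zero[of x] in \<open>simp add: add_nonneg_pos\<close>)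
    also have "\<dots> \<le> norm c * norm x + e"
      using e by (simp add: distrib_right divide_le_eq add_nonneg_pos mult_left_mono)
    finally show "norm (\<pi> c x) \<le> norm c * norm x + e" .
  qed
qed

section \<open>The covariance relation and cut-off seminorms\<close>

lemma zpow_0 [simp]: "zpow g 0 x = x"
  by (simp add: zpow_def)

lemma zpow_add_one:
  assumes "bij g"
  shows "zpow g (k + 1) x = g (zpow g k x)"
proof (cases "0 \<le> k")
  case True
  then have "nat (k + 1) = Suc (nat k)" by simp
  with True show ?thesis by (simp add: zpow_def)
next
  case False
  then have "nat (- k) = Suc (nat (- (k + 1)))" by simp
  with False assms show ?thesis
    by (auto simp: zpow_def bij_is_surj surj_f_inv_f)
qed

lemma zpow_add:
  assumes "bij g"
  shows "zpow g (j + k) x = zpow g j (zpow g k x)"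
proof (induction j rule: int_induct[where k = 0])
  case base
  show ?case by simp
next
  case (step1 i)
  then show ?case
    using zpow_add_one[OF assms, of "i + k" x] zpow_add_one[OF assms, of i "zpow g k x"]
    by (simp add: algebra_simps)
next
  case (step2 i)
  have "g (zpow g (i - 1 + k) x) = g (zpow g (i - 1) (zpow g k x))"
    using zpow_add_one[OF assms, of "i - 1 + k" x] zpow_add_one[OF assms, of "i - 1" "zpow g k x"] step2
    by (simp add: algebra_simps)
  then show ?case using assms by (simp add: bij_is_inj inj_eq)
qed

lemma zpow_neg_cancel [simp]:
  assumes "bij g"
  shows "zpow g k (zpow g (- k) x) = x" "zpow g (- k) (zpow g k x) = x"
  using zpow_add[OF assms, of k "- k" x] zpow_add[OF assms, of "- k" k x] by simp_all

lemma zpow_image_eq_vimage: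
  assumes "bij g"
  shows "zpow g k ` A = zpow g (- k) -` A"
  using zpow_neg_cancel[OF assms] by (auto simp: image_iff) metis

lemma homeomorphism_inv_bij: "homeomorphism UNIV UNIV g (inv g) \<Longrightarrow> bij g"
  by (auto simp: homeomorphism_def intro: bijI inj_on_inverseI)

lemma continuous_on_zpow:
  assumes "homeomorphism UNIV UNIV g (inv g)"
  shows "continuous_on UNIV (zpow g k)"
proof -
  have *: "continuous_on UNIV (f ^^ n)" if "continuous_on UNIV f" for f :: "'a \<Rightarrow> 'a" and n
    using that by (induction n) (auto intro: continuous_on_compose2[of UNIV f])
  show ?thesis
    using assms by (simp add: zpow_def homeomorphism_def *)
qed

section \<open>Functions in C(X) and elements of l^1\<close>

lemma apply_cmult [simp]: "apply_bcontfun (cmult f g) x = f x * g x"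
  by transfer simp

lemma cmult_zero [simp]: "cmult 0 f = 0" "cmult f 0 = 0"
  by (auto intro: bcontfun_eqI)

lemma cmult_commute: "cmult f g = cmult g f"
  by (auto intro: bcontfun_eqI)

lemma cmult_one [simp]: "cmult f (const_bcontfun 1) = f" "cmult (const_bcontfun 1) f = f"
  by (auto intro: bcontfun_eqI)

lemma norm_cmult_le: "norm (cmult f g) \<le> norm f * norm g"
  by (rule norm_bound) (simp add: norm_mult mult_mono norm_bounded)

lemma norm_const_bcontfun_le: "norm (const_bcontfun c :: 'a :: topological_space \<Rightarrow>\<^sub>C 'b :: real_normed_vector) \<le> norm c"
  by (rule norm_bound) (simp add: const_bcontfun.rep_eq)

lemma summable_on_single:
  "(\<lambda>k. if k = n then c else (0 :: 'b :: {comm_monoid_add, topological_space})) summable_on A"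
  by (rule summable_on_cong_neutral[THEN iffD2, of "{n} \<inter> A" A _ "\<lambda>k. if k = n then c else 0"])
     (auto intro: summable_on_finite)

lemma infsum_single:
  "(\<And>k. k \<noteq> n \<Longrightarrow> f k = 0) \<Longrightarrow> infsum f UNIV = (f n :: 'b :: {comm_monoid_add, t2_space})"
  using infsum_cong_neutral[of "{n}" UNIV f f] by simp

lemma l1_single_in_ell1 [simp]: "l1_single n f \<in> ell1"
  using summable_on_single[of n "norm f" UNIV]
  by (simp add: ell1_def l1_single_def if_distrib[of norm] cong: if_cong)

lemma l1_norm_single [simp]: "l1_norm (l1_single n f) = norm f"
  unfolding l1_norm_def by (subst infsum_single[of n]) (simp_all add: l1_single_def)

lemma ell1_restrict [simp]:
  assumes "a \<in> ell1"
  shows "(\<lambda>n. if n \<in> F then a n else 0) \<in> ell1"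
  using assms unfolding ell1_def mem_Collect_eq
  by (rule summable_on_comparison_test) auto

lemma norm_enveloping_le_l1_norm:
  assumes "enveloping_cstar_algebra \<sigma> \<iota>" "a \<in> ell1"
  shows "norm (\<iota> a) \<le> l1_norm a"
proof -
  have "norm (\<iota> a) = (SUP p\<in>{p. l1_cstar_seminorm \<sigma> p}. p a)"
    using assms by (simp add: enveloping_cstar_algebra_def)
  also have "\<dots> \<le> l1_norm a"
  proof (rule cSUP_least)
    \<comment> \<open>The index set of the supremum must be nonempty for \<open>cSUP_least\<close>;
      the zero seminorm belongs to it.\<close>
    have "l1_cstar_seminorm \<sigma> (\<lambda>_. 0)"
      by (auto simp: l1_cstar_seminorm_def l1_norm_def intro: infsum_nonneg)
    then show "{p. l1_cstar_seminorm \<sigma> p} \<noteq> {}" by blast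
    show "p a \<le> l1_norm a" if "p \<in> {p. l1_cstar_seminorm \<sigma> p}" for p
      using that assms(2) by (simp add: l1_cstar_seminorm_def)
  qed
  finally show ?thesis .
qed

text \<open>The measure stays outside: covariance, approximation by finite sums and the seminorms
  are facts about \<sigma>, \<iota> and \<pi>. It enters when the size of sets matters.\<close>

locale enveloping_rep =
  fixes \<sigma> :: "'x::topological_space \<Rightarrow> 'x"
    and \<iota> :: "(int \<Rightarrow> ('x \<Rightarrow>\<^sub>C complex)) \<Rightarrow> 'c::unital_cstar_algebra"
    and \<pi> :: "'c \<Rightarrow> 'k::hilbert_space \<Rightarrow> 'k"
  assumes homeo: "homeomorphism UNIV UNIV \<sigma> (inv \<sigma>)"
    and env: "enveloping_cstar_algebra \<sigma> \<iota>"
    and rep: "star_representation \<pi>"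
begin

definition M :: "('x \<Rightarrow>\<^sub>C complex) \<Rightarrow> 'k \<Rightarrow> 'k" where
  "M f = \<pi> (\<iota> (l1_single 0 f))"

definition U :: "int \<Rightarrow> 'k \<Rightarrow> 'k" where
  "U n = \<pi> (\<iota> (l1_delta n))"

lemma bij_\<sigma>: "bij \<sigma>"
  using homeo by (rule homeomorphism_inv_bij)

text \<open>\<open>alpha\<close> is made by \<open>Bcontfun\<close>, whose value is known only once
  the composite is shown continuous and bounded. Evaluating at \<sigma> x keeps \<open>inv\<close>
  out of later proofs.\<close>

lemma apply_alpha [simp]: "alpha \<sigma> f (\<sigma> x) = f x"
proof -
  have "(\<lambda>y. f (inv \<sigma> y)) \<in> bcontfun"
    using homeo bounded_subset[OF bounded_apply_bcontfun[of f], of "range (\<lambda>y. f (inv \<sigma> y))"]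
    by (auto simp: bcontfun_def homeomorphism_def
        intro!: continuous_on_compose2[OF continuous_on_apply_bcontfun[of UNIV f]])
  then show ?thesis
    by (simp add: alpha_def Bcontfun_inverse bij_\<sigma> bij_is_inj)
qed

lemma alpha_eq_iff: "alpha \<sigma> f = g \<longleftrightarrow> (\<forall>x. g (\<sigma> x) = f x)"
proof
  assume *: "\<forall>x. g (\<sigma> x) = f x"
  show "alpha \<sigma> f = g"
  proof (rule bcontfun_eqI)
    fix y
    obtain x where "y = \<sigma> x" using bij_\<sigma> by (metis bij_pointE)
    with * show "alpha \<sigma> f y = g y" by simp
  qed
qed auto

text \<open>For negative exponents \<open>zpow\<close> uses \<open>inv (alpha \<sigma>)\<close>,
  which is a true inverse only for a bijection.\<close>

lemma bij_alpha: "bij (alpha \<sigma>)"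
proof (rule bijI)
  show "inj (alpha \<sigma>)"
    by (rule injI) (metis apply_alpha bcontfun_eqI)
  show "surj (alpha \<sigma>)"
  proof (rule surjI)
    fix f :: "'x \<Rightarrow>\<^sub>C complex"
    have "(\<lambda>y. f (\<sigma> y)) \<in> bcontfun"
      using homeo bounded_subset[OF bounded_apply_bcontfun[of f], of "range (\<lambda>y. f (\<sigma> y))"]
      by (auto simp: bcontfun_def homeomorphism_def
          intro!: continuous_on_compose2[OF continuous_on_apply_bcontfun[of UNIV f]])
    then show "alpha \<sigma> (Bcontfun (\<lambda>y. f (\<sigma> y))) = f"
      by (simp add: alpha_eq_iff Bcontfun_inverse)
  qed
qed

lemma apply_zpow_alpha: "zpow (alpha \<sigma>) n f (zpow \<sigma> n x) = f x"
proof -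
  \<comment> \<open>One claim for an arbitrary pair A, s serves both signs of n: it is applied to
    \<open>alpha \<sigma>\<close> with \<sigma> and to their inverses.\<close>
  have *: "apply_bcontfun ((A ^^ m) f) ((s ^^ m) x) = f x"
    if "\<And>f x. apply_bcontfun (A f) (s x) = f x"
    for A :: "('x \<Rightarrow>\<^sub>C complex) \<Rightarrow> ('x \<Rightarrow>\<^sub>C complex)" and s m
    by (induction m) (simp_all add: that)
  have "inv (alpha \<sigma>) g (inv \<sigma> y) = g y" for g y
    using apply_alpha[of "inv (alpha \<sigma>) g" "inv \<sigma> y"] bij_\<sigma> bij_alpha
    by (simp add: bij_is_surj surj_f_inv_f)
  then show ?thesis by (simp add: zpow_def *)
qed

lemma zpow_alpha_apply: "zpow (alpha \<sigma>) n f x = f (zpow \<sigma> (- n) x)"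
  using apply_zpow_alpha[of n f "zpow \<sigma> (- n) x"] by (simp add: bij_\<sigma>)

lemma l1_mult_single:
  "l1_mult \<sigma> (l1_single n f) (l1_single m g) = l1_single (n + m) (cmult f (zpow (alpha \<sigma>) n g))"
proof
  fix p
  \<comment> \<open>Only the summand k = n of the convolution survives; for p \<noteq> n + m it
    contains the n-th power of \<open>alpha \<sigma>\<close> at 0, which must be seen to
    vanish.\<close>
  have "zpow (alpha \<sigma>) n 0 = 0" by (rule bcontfun_eqI) (simp add: zpow_alpha_apply)
  then show "l1_mult \<sigma> (l1_single n f) (l1_single m g) p =
      l1_single (n + m) (cmult f (zpow (alpha \<sigma>) n g)) p"
    unfolding l1_mult_def by (subst infsum_single[of n]) (auto simp: l1_single_def)
qed

text \<open>The relations between \<open>M\<close> and \<open>U\<close> below are instances of this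
  one with exponents 0 or functions 1.\<close>

lemma rep_single_mult:
  "\<pi> (\<iota> (l1_single n f)) (\<pi> (\<iota> (l1_single m g)) x)
    = \<pi> (\<iota> (l1_single (n + m) (cmult f (zpow (alpha \<sigma>) n g)))) x"
proof -
  have "\<iota> (l1_mult \<sigma> (l1_single n f) (l1_single m g)) = \<iota> (l1_single n f) * \<iota> (l1_single m g)"
    using env by (simp add: enveloping_cstar_algebra_def)
  moreover have "\<pi> (a * b) x = \<pi> a (\<pi> b x)" for a b
    using rep by (simp add: star_representation_def)
  ultimately show ?thesis by (simp add: l1_mult_single)
qed

lemma M_M: "M f (M g x) = M (cmult f g) x"
  by (simp add: M_def rep_single_mult)

lemma M_U: "M f (U n x) = \<pi> (\<iota> (l1_single n f)) x"
  by (simp add: M_def U_def l1_delta_def rep_single_mult)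

lemma U_M: "U n (M f x) = M (zpow (alpha \<sigma>) n f) (U n x)"
  by (simp add: M_U) (simp add: M_def U_def l1_delta_def rep_single_mult)

lemma rep_norm_le:
  assumes "a \<in> ell1"
  shows "norm (\<pi> (\<iota> a) x) \<le> l1_norm a * norm x"
  using star_representation_norm_le[OF rep, of "\<iota> a" x] norm_enveloping_le_l1_norm[OF env assms]
    mult_right_mono[of "norm (\<iota> a)" "l1_norm a" "norm x"] by simp

lemma norm_M_le: "norm (M f x) \<le> norm f * norm x"
  using rep_norm_le[of "l1_single 0 f" x] by (simp add: M_def)

lemma norm_U_le: "norm (U n x) \<le> norm x"
proof -
  have "norm (U n x) \<le> norm (const_bcontfun 1 :: 'x \<Rightarrow>\<^sub>C complex) * norm x"
    using rep_norm_le[of "l1_delta n" x] by (simp add: U_def l1_delta_def)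
  with norm_const_bcontfun_le[of "1 :: complex", where 'a = 'x]
    mult_right_mono[of "norm (const_bcontfun 1 :: 'x \<Rightarrow>\<^sub>C complex)" 1 "norm x"]
  show ?thesis by simp
qed

lemma M_add: "M f (x + y) = M f x + M f y" and M_scaleC: "M f (scaleC c x) = scaleC c (M f x)"
  using rep by (simp_all add: M_def star_representation_def bounded_clinear_def linear_simps)

lemma rep_zero: "\<pi> (\<iota> (\<lambda>_. 0)) x = 0"
proof -
  have "l1_single 0 0 = (\<lambda>_. 0 :: 'x \<Rightarrow>\<^sub>C complex)" by (auto simp: l1_single_def)
  with rep_norm_le[OF l1_single_in_ell1, of 0 0 x] l1_norm_single[of 0 "0 :: 'x \<Rightarrow>\<^sub>C complex"]
  show ?thesis by simp
qed

lemma rep_l1_add: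
  assumes "a \<in> ell1" "b \<in> ell1"
  shows "\<pi> (\<iota> (l1_add a b)) x = \<pi> (\<iota> a) x + \<pi> (\<iota> b) x"
  using env rep assms by (simp add: enveloping_cstar_algebra_def star_representation_def)

lemma rep_restrict_finite:
  assumes "finite F" "a \<in> ell1"
  shows "\<pi> (\<iota> (\<lambda>n. if n \<in> F then a n else 0)) x = (\<Sum>n\<in>F. M (a n) (U n x))"
  using assms(1)
proof (induction F rule: finite_induct)
  case empty
  show ?case by (simp add: rep_zero)
next
  case (insert m F)
  have "(\<lambda>n. if n \<in> insert m F then a n else 0)
      = l1_add (l1_single m (a m)) (\<lambda>n. if n \<in> F then a n else 0)"
    using insert.hyps by (auto simp: l1_add_def l1_single_def)
  with insert assms(2) show ?case by (simp add: rep_l1_add M_U)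
qed

text \<open>The error is the image of the tail of a, whose l^1 norm is small. The bound on the
  partial sum is exported too, so that later constants do not depend on F.\<close>

lemma rep_approx_finite_sum:
  assumes a: "a \<in> ell1" and e: "0 < e"
  obtains F where "finite F" "norm (\<pi> (\<iota> a) x - (\<Sum>n\<in>F. M (a n) (U n x))) \<le> e"
    "(\<Sum>n\<in>F. norm (a n)) \<le> l1_norm a"
proof -
  have sum: "(\<lambda>n. norm (a n)) summable_on UNIV" using a by (simp add: ell1_def)
  obtain F where F: "finite F" "dist (\<Sum>n\<in>F. norm (a n)) (l1_norm a) \<le> e / (norm x + 1)"
    using infsum_finite_approximation[OF sum, of "e / (norm x + 1)"] e
    by (auto simp: l1_norm_def add_nonneg_pos)
  let ?b = "\<lambda>n. if n \<in> F then a n else 0" and ?c = "\<lambda>n. if n \<in> - F then a n else 0"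
  have "a = l1_add ?b ?c" by (auto simp: l1_add_def)
  then have eq: "\<pi> (\<iota> a) x - (\<Sum>n\<in>F. M (a n) (U n x)) = \<pi> (\<iota> ?c) x"
    using rep_l1_add[OF ell1_restrict[OF a] ell1_restrict[OF a], of F "- F" x]
      rep_restrict_finite[OF F(1) a, of x] by simp
  have le: "norm (\<pi> (\<iota> ?c) x) \<le> l1_norm ?c * norm x" using a by (intro rep_norm_le ell1_restrict)
  have c: "0 \<le> l1_norm ?c" unfolding l1_norm_def by (rule infsum_nonneg) auto
  have split: "l1_norm a = (\<Sum>n\<in>F. norm (a n)) + l1_norm ?c"
  proof -
    have "l1_norm a = infsum (\<lambda>n. norm (a n)) (F \<union> - F)" by (simp add: l1_norm_def)
    also have "\<dots> = infsum (\<lambda>n. norm (a n)) F + infsum (\<lambda>n. norm (a n)) (- F)"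
      using sum by (intro infsum_Un_disjoint summable_on_subset_banach[OF sum]) auto
    also have "infsum (\<lambda>n. norm (a n)) (- F) = l1_norm ?c"
      unfolding l1_norm_def by (rule infsum_cong_neutral) auto
    finally show ?thesis using F(1) by simp
  qed
  have "l1_norm ?c * norm x \<le> e"
  proof -
    have "l1_norm ?c \<le> e / (norm x + 1)" using F(2) split c by (simp add: dist_real_def)
    with c have "l1_norm ?c * norm x \<le> e / (norm x + 1) * (norm x + 1)"
      by (intro mult_mono) auto
    also have "\<dots> = e"
      using norm_ge_zero[of x] by (simp add: add_nonneg_eq_0_iff)
    finally show ?thesis .
  qed
  with le have "norm (\<pi> (\<iota> a) x - (\<Sum>n\<in>F. M (a n) (U n x))) \<le> e" unfolding eq by linarith
  then show ?thesis using that[OF F(1)] c split by linarith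
qed

section \<open>Seminorms measuring a vector over a subset of X\<close>

definition cutoff :: "'x set \<Rightarrow> ('x \<Rightarrow>\<^sub>C complex) set" where
  "cutoff K = {f. norm f \<le> 1 \<and> (\<forall>x\<in>K. apply_bcontfun f x = 1)}"

text \<open>For closed \<open>K\<close> this is the norm of the component of the vector over \<open>K\<close>.\<close>

definition cut_norm :: "'x set \<Rightarrow> 'k \<Rightarrow> real" where
  "cut_norm K x = (INF f\<in>cutoff K. norm (M f x))"

lemma cut_norm_le: "f \<in> cutoff K \<Longrightarrow> cut_norm K x \<le> norm (M f x)"
  unfolding cut_norm_def by (rule cINF_lower) (auto intro: bdd_belowI[of _ 0])

lemma const_in_cutoff: "const_bcontfun 1 \<in> cutoff K"
  using norm_const_bcontfun_le[of "1 :: complex", where 'a = 'x] by (simp add: cutoff_def)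

lemma cut_norm_greatest: "(\<And>f. f \<in> cutoff K \<Longrightarrow> c \<le> norm (M f x)) \<Longrightarrow> c \<le> cut_norm K x"
  unfolding cut_norm_def using const_in_cutoff by (intro cINF_greatest) auto

lemma norm_M_cutoff_le:
  assumes "f \<in> cutoff K"
  shows "norm (M f x) \<le> norm x"
  using norm_M_le[of f x] assms mult_right_mono[of "norm f" 1 "norm x"] by (simp add: cutoff_def)

lemma cut_norm_le_norm: "cut_norm K x \<le> norm x"
  using cut_norm_le[OF const_in_cutoff, of K x] norm_M_cutoff_le[OF const_in_cutoff, of x]
  by linarith

text \<open>A cut-off good for x may be bad for y. If f is good for x and g for y, their product is
  a cut-off good for both, because \<open>M f\<close> and \<open>M g\<close> commute and are
  contractions.\<close>

lemma cut_norm_add: "cut_norm K (x + y) \<le> cut_norm K x + cut_norm K y"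
proof -
  have *: "cut_norm K (x + y) \<le> norm (M f x) + norm (M g y)"
    if f: "f \<in> cutoff K" and g: "g \<in> cutoff K" for f g
  proof -
    have "norm (cmult f g) \<le> 1"
      using norm_cmult_le[of f g] mult_mono[of "norm f" 1 "norm g" 1] f g by (simp add: cutoff_def)
    with f g have fg: "cmult f g \<in> cutoff K" by (simp add: cutoff_def)
    have "M (cmult f g) (x + y) = M g (M f x) + M f (M g y)"
      by (simp add: M_M M_add cmult_commute[of f g])
    then have "norm (M (cmult f g) (x + y)) \<le> norm (M g (M f x)) + norm (M f (M g y))"
      by (simp add: norm_triangle_ineq)
    then show ?thesis
      using cut_norm_le[OF fg, of "x + y"] norm_M_cutoff_le[OF f, of "M g y"]
        norm_M_cutoff_le[OF g, of "M f x"]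
      by linarith
  qed
  have "cut_norm K (x + y) - norm (M g y) \<le> cut_norm K x" if "g \<in> cutoff K" for g
    using *[OF _ that] by (intro cut_norm_greatest) (simp add: algebra_simps)
  then have "cut_norm K (x + y) - cut_norm K x \<le> cut_norm K y"
    by (intro cut_norm_greatest) (simp add: algebra_simps)
  then show ?thesis by simp
qed

lemma cut_norm_sum: "cut_norm K (\<Sum>i\<in>F. x i) \<le> (\<Sum>i\<in>F. cut_norm K (x i))"
proof (induction F rule: infinite_finite_induct)
  case (insert i F)
  then show ?case using cut_norm_add[of K "x i" "sum x F"] by simp
qed (use cut_norm_le_norm[of K 0] in auto)

text \<open>Common pattern of the next three bounds: each cut-off f for x is transported to a
  cut-off g for y at cost c.\<close>

lemma cut_norm_contraction:
  assumes "\<And>f. f \<in> cutoff K \<Longrightarrow> \<exists>g\<in>cutoff L. norm (M g y) \<le> c * norm (M f x)" "0 \<le> c"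
  shows "cut_norm L y \<le> c * cut_norm K x"
proof (cases "c = 0")
  case True
  with assms(1)[OF const_in_cutoff] show ?thesis using cut_norm_le[of _ L y] by fastforce
next
  case False
  with assms(2) have c: "0 < c" by simp
  have "cut_norm L y / c \<le> cut_norm K x"
  proof (rule cut_norm_greatest)
    fix f assume "f \<in> cutoff K"
    then obtain g where "g \<in> cutoff L" "norm (M g y) \<le> c * norm (M f x)" using assms(1) by blast
    then show "cut_norm L y / c \<le> norm (M f x)"
      using cut_norm_le[of g L y] c by (simp add: field_simps)
  qed
  with c show ?thesis by (simp add: field_simps)
qed

lemma cut_norm_scaleC: "cut_norm K (scaleC c x) \<le> cmod c * cut_norm K x"
  by (rule cut_norm_contraction) (auto simp: M_scaleC norm_scaleC)

lemma cut_norm_M: "cut_norm K (M g x) \<le> norm g * cut_norm K x"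
proof (rule cut_norm_contraction)
  fix f assume "f \<in> cutoff K"
  moreover have "M f (M g x) = M g (M f x)" by (simp add: M_M cmult_commute[of f g])
  ultimately show "\<exists>h\<in>cutoff K. norm (M h (M g x)) \<le> norm g * norm (M f x)"
    using norm_M_le[of g "M f x"] by metis
qed simp

text \<open>If f is 1 on the translated set, the n-th power of \<open>alpha \<sigma>\<close> moves
  it to a function that is 1 on K, and by \<open>U_M\<close> that function acts on U n x as U n
  applied to M f x.\<close>

lemma cut_norm_U: "cut_norm K (U n x) \<le> cut_norm (zpow \<sigma> (- n) ` K) x"
proof -
  have "cut_norm K (U n x) \<le> 1 * cut_norm (zpow \<sigma> (- n) ` K) x"
  proof (rule cut_norm_contraction)
    fix f assume f: "f \<in> cutoff (zpow \<sigma> (- n) ` K)"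
    have "norm (zpow (alpha \<sigma>) n f) \<le> norm f"
      by (rule norm_bound) (simp add: zpow_alpha_apply norm_bounded)
    with f have "zpow (alpha \<sigma>) n f \<in> cutoff K"
      by (auto simp: cutoff_def zpow_alpha_apply)
    moreover have "norm (M (zpow (alpha \<sigma>) n f) (U n x)) \<le> 1 * norm (M f x)"
      using norm_U_le[of n "M f x"] by (simp add: U_M)
    ultimately show "\<exists>g\<in>cutoff K. norm (M g (U n x)) \<le> 1 * norm (M f x)" by blast
  qed simp
  then show ?thesis by simp
qed

text \<open>The bound c has to hold for all n at once: a finite sum then costs the sum of the norm
  (a n) times c, and the remainder is absorbed by \<open>cut_norm_le_norm\<close>.\<close>

lemma cut_norm_rep_le:
  assumes a: "a \<in> ell1" and x: "\<And>n. cut_norm K (U n x) \<le> c" and c: "0 \<le> c"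
  shows "cut_norm K (\<pi> (\<iota> a) x) \<le> l1_norm a * c"
proof (rule field_le_epsilon)
  fix e :: real assume "0 < e"
  then obtain F where F: "finite F" "norm (\<pi> (\<iota> a) x - (\<Sum>n\<in>F. M (a n) (U n x))) \<le> e"
    "(\<Sum>n\<in>F. norm (a n)) \<le> l1_norm a"
    using rep_approx_finite_sum[OF a] by metis
  let ?s = "\<Sum>n\<in>F. M (a n) (U n x)"
  have "cut_norm K ?s \<le> (\<Sum>n\<in>F. cut_norm K (M (a n) (U n x)))" by (rule cut_norm_sum)
  also have "\<dots> \<le> (\<Sum>n\<in>F. norm (a n) * c)"
    using x by (intro sum_mono order_trans[OF cut_norm_M] mult_left_mono) auto
  also have "\<dots> \<le> l1_norm a * c"
    using F(3) c by (simp add: sum_distrib_right[symmetric] mult_right_mono)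
  finally have "cut_norm K ?s \<le> l1_norm a * c" .
  moreover have "cut_norm K (\<pi> (\<iota> a) x) \<le> cut_norm K ?s + cut_norm K (\<pi> (\<iota> a) x - ?s)"
    using cut_norm_add[of K ?s "\<pi> (\<iota> a) x - ?s"] by simp
  ultimately show "cut_norm K (\<pi> (\<iota> a) x) \<le> l1_norm a * c + e"
    using cut_norm_le_norm[of K "\<pi> (\<iota> a) x - ?s"] F(2) by linarith
qed

end

section \<open>Regularity and measures of translates\<close>

lemma metrizable_euclidean_obtain:
  assumes "metrizable_space (euclidean :: 'x::topological_space topology)"
  obtains d :: "'x::topological_space \<Rightarrow> 'x::topological_space \<Rightarrow> real"
    where "Metric_space UNIV d" "Metric_space.mtopology UNIV d = euclidean"
proof -
  obtain M d where Md: "Metric_space M d" "euclidean = Metric_space.mtopology M (d :: 'x \<Rightarrow> 'x \<Rightarrow> real)"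
    using assms unfolding metrizable_space_def by blast
  have "M = UNIV" using Metric_space.topspace_mtopology[OF Md(1)] Md(2) by (metis topspace_euclidean)
  with Md that show ?thesis by simp
qed

text \<open>The distance to K works. It serves twice: open sets become countable unions of closed
  sets, and the indicator of K becomes a limit of continuous cut-offs.\<close>

lemma closed_zero_set:
  fixes K :: "'x::topological_space set"
  assumes metr: "metrizable_space (euclidean :: 'x topology)" and K: "closed K"
  obtains g :: "'x \<Rightarrow> real" where "continuous_on UNIV g" "\<And>x. 0 \<le> g x" "\<And>x. g x = 0 \<longleftrightarrow> x \<in> K"
proof (cases "K = {}")
  case True
  \<comment> \<open>An infimum over the empty set would carry no information, so the distance is
    replaced by a constant.\<close>
  then show ?thesis using that[of "\<lambda>_. 1"] by simp
next
  case False
  obtain d where d: "Metric_space UNIV d" "Metric_space.mtopology UNIV d = (euclidean :: 'x topology)"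
    using metrizable_euclidean_obtain[OF metr] .
  interpret D: Metric_space UNIV d by (rule d)
  have open_ball: "open (D.mball x r)" for x r
    using D.openin_mball[of x r] by (simp add: d(2))
  define g where "g x = (INF y\<in>K. d x y)" for x
  have bdd: "bdd_below (d x ` K)" for x by (rule bdd_belowI[of _ 0]) auto
  have Lipschitz: "g x \<le> d x y + g y" for x y
  proof -
    have "g x - d x y \<le> g y" unfolding g_def[of y]
    proof (rule cINF_greatest[OF False])
      fix z assume "z \<in> K"
      then have "g x \<le> d x z" unfolding g_def by (rule cINF_lower[OF bdd])
      with D.triangle[of x y z] show "g x - d x y \<le> d y z" by simp
    qed
    then show ?thesis by simp
  qed
  have "continuous_on UNIV g"
    unfolding continuous_on_def
  proof (intro ballI tendstoI)
    fix x and e :: real assume e: "0 < e"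
    have "dist (g y) (g x) < e" if "y \<in> D.mball x e" for y
      using Lipschitz[of x y] Lipschitz[of y x] that by (simp add: dist_real_def D.commute[of y x])
    then show "\<forall>\<^sub>F y in at x. dist (g y) (g x) < e"
      unfolding eventually_at_topological using open_ball e by (intro exI[of _ "D.mball x e"]) auto
  qed
  moreover have "0 \<le> g x" for x unfolding g_def using False by (intro cINF_greatest) auto
  moreover have "g x = 0 \<longleftrightarrow> x \<in> K" for x
  proof
    assume x: "x \<in> K"
    have "g x \<le> d x x" unfolding g_def by (rule cINF_lower[OF bdd x])
    with \<open>0 \<le> g x\<close> show "g x = 0" by simp
  next
    assume 0: "g x = 0"
    show "x \<in> K"
    proof (rule ccontr)
      assume "x \<notin> K"
      moreover have "openin D.mtopology (- K)" using K by (simp add: d(2) open_Compl)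
      ultimately obtain r where r: "0 < r" "D.mball x r \<subseteq> - K" by (auto simp: D.openin_mtopology)
      have "r \<le> d x y" if "y \<in> K" for y
      proof -
        have "y \<notin> D.mball x r" using that r(2) by blast
        then show ?thesis by simp
      qed
      then have "r \<le> g x" unfolding g_def using False by (intro cINF_greatest) auto
      with 0 r(1) show False by simp
    qed
  qed
  ultimately show ?thesis by (rule that)
qed

text \<open>The sets with this approximation form a sigma-algebra containing the open sets. Inner
  and outer approximation are carried together because complementation exchanges them.\<close>

lemma closed_open_regular:
  fixes B :: "'x::topological_space set"
  assumes metr: "metrizable_space (euclidean :: 'x topology)"
    and sets: "sets \<mu> = sets borel" and fin: "finite_measure \<mu>"
    and B: "B \<in> sets borel" and e: "0 < e"
  shows "\<exists>C G. closed C \<and> open G \<and> C \<subseteq> B \<and> B \<subseteq> G \<and> measure \<mu> (G - C) < e"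
  using B[unfolded sets_borel] e
proof (induction arbitrary: e rule: sigma_sets.induct)
  case (Basic G)
  then have G: "open G" by simp
  interpret finite_measure \<mu> by (rule fin)
  obtain g :: "'x \<Rightarrow> real" where g: "continuous_on UNIV g" "\<And>x. 0 \<le> g x" "\<And>x. g x = 0 \<longleftrightarrow> x \<in> - G"
    using closed_zero_set[OF metr, of "- G"] G by auto
  define C where "C n = {x. 1 / real (Suc n) \<le> g x}" for n
  have C: "closed (C n)" for n
    unfolding C_def using g(1) by (intro closed_Collect_le continuous_intros) auto
  have CG: "C n \<subseteq> G" for n
  proof
    fix x assume "x \<in> C n"
    then have "0 < g x" unfolding C_def by (smt (verit) divide_pos_pos mem_Collect_eq of_nat_0_less_iff zero_less_Suc)
    then show "x \<in> G" using g(3)[of x] by auto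
  qed
  have "1 / real (Suc (Suc n)) \<le> 1 / real (Suc n)" for n by (simp add: field_simps)
  then have "incseq C" unfolding incseq_Suc_iff C_def using order_trans by blast
  moreover have "(\<Union>n. C n) = G"
  proof
    show "G \<subseteq> (\<Union>n. C n)"
    proof
      fix x assume "x \<in> G"
      then have "0 < g x" using g(2)[of x] g(3)[of x] by fastforce
      then obtain n where "1 / real (Suc n) < g x"
        by (metis inverse_eq_divide reals_Archimedean)
      then show "x \<in> (\<Union>n. C n)" unfolding C_def by (auto intro: less_imp_le)
    qed
  qed (use CG in auto)
  moreover have "range C \<subseteq> sets \<mu>" using C sets by (simp add: image_subset_iff)
  ultimately have "(\<lambda>n. measure \<mu> (C n)) \<longlonglongrightarrow> measure \<mu> G"
    using finite_Lim_measure_incseq[of C] by simp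
  then have "\<forall>\<^sub>F n in sequentially. dist (measure \<mu> (C n)) (measure \<mu> G) < e"
    using Basic(2) by (rule tendstoD)
  then obtain n where "dist (measure \<mu> (C n)) (measure \<mu> G) < e"
    using eventually_happens'[OF sequentially_bot] by blast
  moreover have "measure \<mu> (G - C n) = measure \<mu> G - measure \<mu> (C n)"
    using CG C G sets by (intro finite_measure_Diff) auto
  ultimately show ?case using C CG G by (intro exI[of _ "C n"] exI[of _ G]) (auto simp: dist_real_def)
next
  case Empty
  then show ?case by (intro exI[of _ "{}"]) auto
next
  case (Compl B)
  from Compl.IH[OF Compl.prems] obtain C G where
    "closed C" "open G" "C \<subseteq> B" "B \<subseteq> G" "measure \<mu> (G - C) < e" by blast
  moreover have "(UNIV - C) - (UNIV - G) = G - C" by auto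
  ultimately show ?case by (intro exI[of _ "UNIV - G"] exI[of _ "UNIV - C"]) auto
next
  case (Union B)
  interpret finite_measure \<mu> by (rule fin)
  \<comment> \<open>Half of e is shared out geometrically among the B i; the other half pays for
    replacing the infinite union of the C i, which need not be closed, by a finite one.\<close>
  have "\<exists>C G. closed C \<and> open G \<and> C \<subseteq> B i \<and> B i \<subseteq> G \<and> measure \<mu> (G - C) < e / 2 * (1/2) ^ Suc i" for i
    using Union.prems by (intro Union.IH) simp
  then obtain C G where CG: "\<And>i. closed (C i)" "\<And>i. open (G i)" "\<And>i. C i \<subseteq> B i" "\<And>i. B i \<subseteq> G i"
    "\<And>i. measure \<mu> (G i - C i) < e / 2 * (1/2) ^ Suc i"
    by metis
  define D where "D n = (\<Union>i\<le>n. C i)" for n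
  have meas: "C i \<in> sets \<mu>" "G i \<in> sets \<mu>" "D i \<in> sets \<mu>" for i
    using CG sets by (auto simp: D_def)
  have series: "(\<lambda>i. e / 2 * (1/2) ^ Suc i) sums (e / 2)"
    using sums_mult[OF power_half_series, of "e / 2"] by simp
  have summ: "summable (\<lambda>i. measure \<mu> (G i - C i))"
    by (rule summable_comparison_test'[OF sums_summable[OF series], of 0]) (use CG(5) in \<open>auto intro: less_imp_le\<close>)
  have "measure \<mu> (\<Union>i. G i - C i) \<le> (\<Sum>i. measure \<mu> (G i - C i))"
    using meas summ by (intro finite_measure_subadditive_countably) auto
  also have "\<dots> \<le> (\<Sum>i. e / 2 * (1/2) ^ Suc i)"
    using summ sums_summable[OF series] CG(5) by (intro suminf_le) (auto intro: less_imp_le)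
  also have "\<dots> = e / 2" using series by (rule sums_unique[symmetric])
  finally have 1: "measure \<mu> (\<Union>i. G i - C i) \<le> e / 2" .
  have "incseq D" unfolding incseq_def D_def by (intro allI impI UN_mono) auto
  moreover have "(\<Union>n. D n) = (\<Union>i. C i)" by (auto simp: D_def)
  moreover have "range D \<subseteq> sets \<mu>" using meas(3) by blast
  ultimately have "(\<lambda>n. measure \<mu> (D n)) \<longlonglongrightarrow> measure \<mu> (\<Union>i. C i)"
    using finite_Lim_measure_incseq[of D] by simp
  then have "\<forall>\<^sub>F n in sequentially. dist (measure \<mu> (D n)) (measure \<mu> (\<Union>i. C i)) < e / 2"
    using Union.prems by (intro tendstoD) auto
  then obtain n where "dist (measure \<mu> (D n)) (measure \<mu> (\<Union>i. C i)) < e / 2"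
    using eventually_happens'[OF sequentially_bot] by blast
  moreover have "measure \<mu> ((\<Union>i. C i) - D n) = measure \<mu> (\<Union>i. C i) - measure \<mu> (D n)"
    using meas by (intro finite_measure_Diff) (auto simp: D_def)
  ultimately have 2: "measure \<mu> ((\<Union>i. C i) - D n) < e / 2" unfolding dist_real_def by linarith
  have "measure \<mu> ((\<Union>i. G i) - D n) \<le> measure \<mu> ((\<Union>i. G i - C i) \<union> ((\<Union>i. C i) - D n))"
    using meas by (intro finite_measure_mono) auto
  also have "\<dots> \<le> measure \<mu> (\<Union>i. G i - C i) + measure \<mu> ((\<Union>i. C i) - D n)"
    using meas by (intro measure_Un_le) auto
  finally have "measure \<mu> ((\<Union>i. G i) - D n) < e" using 1 2 by simp
  moreover have "closed (D n)" unfolding D_def using CG(1) by (intro closed_UN) auto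
  moreover have "D n \<subseteq> (\<Union>i. B i)" unfolding D_def using CG(3) by blast
  moreover have "(\<Union>i. B i) \<subseteq> (\<Union>i. G i)" using CG(4) by blast
  ultimately show ?case using CG(2) by (intro exI[of _ "D n"] exI[of _ "\<Union>i. G i"]) auto
qed

section \<open>Suprema of measures along orbits\<close>

definition orbit_sup :: "('x \<Rightarrow> 'x) \<Rightarrow> 'x measure \<Rightarrow> 'x set \<Rightarrow> real" where
  "orbit_sup \<sigma> \<mu> A = (SUP k::int. measure \<mu> (zpow \<sigma> k ` A))"

lemma small_translates_iff:
  "small_translates \<sigma> \<mu> \<longleftrightarrow>
    (\<forall>\<epsilon>>0. \<exists>A\<in>sets borel. 0 < orbit_sup \<sigma> \<mu> A \<and> orbit_sup \<sigma> \<mu> A < \<epsilon>)"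
  by (simp add: small_translates_def orbit_sup_def)

lemma (in prob_space) measure_zpow_le_orbit_sup: "measure M (zpow \<sigma> k ` A) \<le> orbit_sup \<sigma> M A"
  unfolding orbit_sup_def by (rule cSUP_upper) (auto intro: bdd_aboveI[of _ 1])

lemma (in prob_space) measure_le_orbit_sup: "measure M A \<le> orbit_sup \<sigma> M A"
  using measure_zpow_le_orbit_sup[of \<sigma> 0 A] by simp

lemma orbit_sup_least: "(\<And>k. measure \<mu> (zpow \<sigma> k ` A) \<le> c) \<Longrightarrow> orbit_sup \<sigma> \<mu> A \<le> c"
  unfolding orbit_sup_def by (rule cSUP_least) auto

lemma orbit_sup_zpow:
  assumes "bij \<sigma>"
  shows "orbit_sup \<sigma> \<mu> (zpow \<sigma> n ` A) = orbit_sup \<sigma> \<mu> A"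
proof -
  have "zpow \<sigma> k ` zpow \<sigma> n ` A = zpow \<sigma> (k + n) ` A" for k
    by (simp add: image_image zpow_add[OF assms])
  moreover have "range (\<lambda>k. measure \<mu> (zpow \<sigma> (k + n) ` A))
      = (\<lambda>k. measure \<mu> (zpow \<sigma> k ` A)) ` range (\<lambda>k. k + n)"
    by (simp only: image_image)
  moreover have "range (\<lambda>k. k + n) = UNIV" by (metis diff_add_cancel surjI)
  ultimately show ?thesis by (simp add: orbit_sup_def)
qed

lemma zpow_image_borel:
  assumes "homeomorphism UNIV UNIV \<sigma> (inv \<sigma>)" "A \<in> sets borel"
  shows "zpow \<sigma> k ` A \<in> sets borel"
proof -
  have "bij \<sigma>" using assms(1) by (rule homeomorphism_inv_bij)
  moreover have "zpow \<sigma> (- k) \<in> borel_measurable borel"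
    by (intro borel_measurable_continuous_onI continuous_on_zpow assms)
  ultimately show ?thesis
    using assms(2) measurable_sets[of "zpow \<sigma> (- k)" borel borel A]
    by (simp add: zpow_image_eq_vimage)
qed

lemma zpow_image_closed:
  assumes "homeomorphism UNIV UNIV \<sigma> (inv \<sigma>)" "closed A"
  shows "closed (zpow \<sigma> k ` A)"
proof -
  have "bij \<sigma>" using assms(1) by (rule homeomorphism_inv_bij)
  then show ?thesis
    using assms continuous_on_zpow[OF assms(1), of "- k"]
    by (simp add: zpow_image_eq_vimage closed_vimage)
qed

text \<open>Only the supremum over the translates of A is known to be positive, so A is first
  replaced by a translate B of positive measure, which has the same \<open>orbit_sup\<close>; a
  closed subset of B has no larger one.\<close>

lemma small_translates_closed:
  fixes \<sigma> :: "'x::topological_space \<Rightarrow> 'x"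
  assumes metr: "metrizable_space (euclidean :: 'x topology)"
    and sets: "sets \<mu> = sets borel" and prob: "prob_space \<mu>"
    and homeo: "homeomorphism UNIV UNIV \<sigma> (inv \<sigma>)"
    and small: "small_translates \<sigma> \<mu>" and e: "0 < e"
  obtains K where "closed K" "0 < measure \<mu> K" "orbit_sup \<sigma> \<mu> K < e"
proof -
  interpret prob_space \<mu> by (rule prob)
  have bij: "bij \<sigma>" using homeo by (rule homeomorphism_inv_bij)
  obtain A where A: "A \<in> sets borel" "0 < orbit_sup \<sigma> \<mu> A" "orbit_sup \<sigma> \<mu> A < e"
    using small e unfolding small_translates_iff by blast
  obtain k where k: "0 < measure \<mu> (zpow \<sigma> k ` A)"
    using orbit_sup_least[of \<mu> \<sigma> A 0] A(2) by (meson not_le)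
  define B where "B = zpow \<sigma> k ` A"
  have B: "B \<in> sets borel" unfolding B_def by (rule zpow_image_borel[OF homeo A(1)])
  \<comment> \<open>With the measure of B as tolerance, the closed part C cannot be null.\<close>
  obtain C G where C: "closed C" "open G" "C \<subseteq> B" "B \<subseteq> G" "measure \<mu> (G - C) < measure \<mu> B"
    using closed_open_regular[OF metr sets finite_measure_axioms B k[folded B_def]] by blast
  have "measure \<mu> B \<le> measure \<mu> ((G - C) \<union> C)"
    using C B sets by (intro finite_measure_mono) auto
  also have "\<dots> \<le> measure \<mu> (G - C) + measure \<mu> C"
    using C sets by (intro measure_Un_le) auto
  finally have "0 < measure \<mu> C" using C(5) by simp
  moreover have "orbit_sup \<sigma> \<mu> C \<le> orbit_sup \<sigma> \<mu> B"
  proof (rule orbit_sup_least)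
    fix j
    have "measure \<mu> (zpow \<sigma> j ` C) \<le> measure \<mu> (zpow \<sigma> j ` B)"
      using C(3) zpow_image_borel[OF homeo B] sets by (intro finite_measure_mono) auto
    also have "\<dots> \<le> orbit_sup \<sigma> \<mu> B" by (rule measure_zpow_le_orbit_sup)
    finally show "measure \<mu> (zpow \<sigma> j ` C) \<le> orbit_sup \<sigma> \<mu> B" .
  qed
  moreover have "orbit_sup \<sigma> \<mu> B = orbit_sup \<sigma> \<mu> A" unfolding B_def by (rule orbit_sup_zpow[OF bij])
  ultimately show ?thesis using that C(1) A(3) by force
qed

section \<open>Two sufficient conditions for small translates\<close>

lemma non_atomic_small_set:
  assumes prob: "prob_space \<mu>" and na: "non_atomic \<mu>" and e: "0 < e"
  obtains A where "A \<in> sets \<mu>" "0 < measure \<mu> A" "measure \<mu> A < e"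
proof -
  interpret prob_space \<mu> by (rule prob)
  have "\<exists>A\<in>sets \<mu>. 0 < measure \<mu> A \<and> measure \<mu> A \<le> (1/2) ^ n" for n
  proof (induction n)
    case 0
    then show ?case using prob_space by (intro bexI[of _ "space \<mu>"]) auto
  next
    case (Suc n)
    then obtain A where A: "A \<in> sets \<mu>" "0 < measure \<mu> A" "measure \<mu> A \<le> (1/2) ^ n" by blast
    have "0 < emeasure \<mu> A" using A(2) by (simp add: emeasure_eq_measure)
    then obtain B where B: "B \<in> sets \<mu>" "B \<subseteq> A" "emeasure \<mu> B \<noteq> 0" "emeasure \<mu> B \<noteq> emeasure \<mu> A"
      using na A(1) unfolding non_atomic_def by blast
    have "measure \<mu> (A - B) = measure \<mu> A - measure \<mu> B"
      using A B by (intro finite_measure_Diff)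
    moreover have "0 < measure \<mu> B" "measure \<mu> B \<noteq> measure \<mu> A"
      using B(3,4) by (auto simp: emeasure_eq_measure zero_less_measure_iff)
    moreover have "measure \<mu> B \<le> measure \<mu> A" using A B by (intro finite_measure_mono)
    \<comment> \<open>B and A - B both have positive measure, and the smaller of them has at most
      half the measure of A.\<close>
    ultimately have "0 < measure \<mu> B \<and> measure \<mu> B \<le> (1/2) ^ Suc n \<or>
        0 < measure \<mu> (A - B) \<and> measure \<mu> (A - B) \<le> (1/2) ^ Suc n"
      using A(3) by auto
    then show ?case using A(1) B(1) by (auto intro: sets.Diff)
  qed
  moreover obtain n where "(1/2 :: real) ^ n < e" using e real_arch_pow_inv[of e "1/2"] by auto
  ultimately show ?thesis using that by (meson le_less_trans)
qed

lemma measure_invariant_small_translates: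
  assumes sets: "sets \<mu> = sets borel" and prob: "prob_space \<mu>"
    and homeo: "homeomorphism UNIV UNIV \<sigma> (inv \<sigma>)"
    and na: "non_atomic \<mu>" and inv: "measure_invariant \<sigma> \<mu>"
  shows "small_translates \<sigma> \<mu>"
  unfolding small_translates_iff
proof (intro allI impI)
  fix e :: real assume "0 < e"
  then obtain A where A: "A \<in> sets \<mu>" "0 < measure \<mu> A" "measure \<mu> A < e"
    using non_atomic_small_set[OF prob na] by blast
  have bij: "bij \<sigma>" using homeo by (rule homeomorphism_inv_bij)
  \<comment> \<open>Invariance is stated for preimages; the preimage of the image under the power k
    + 1 is the image under the power k.\<close>
  have step: "measure \<mu> (zpow \<sigma> (k + 1) ` A) = measure \<mu> (zpow \<sigma> k ` A)" for k
  proof -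
    have "\<sigma> -` (zpow \<sigma> (k + 1) ` A) = zpow \<sigma> k ` A"
      using bij by (auto simp: zpow_add_one inj_eq bij_is_inj)
    then show ?thesis
      using inv zpow_image_borel[OF homeo, of A "k + 1"] A(1) sets
      unfolding measure_invariant_def by metis
  qed
  have "measure \<mu> (zpow \<sigma> k ` A) = measure \<mu> A" for k
  proof (induction k rule: int_induct[where k = 0])
    case (step2 i)
    then show ?case using step[of "i - 1"] by simp
  qed (simp_all add: step)
  then have "orbit_sup \<sigma> \<mu> A = measure \<mu> A" by (simp add: orbit_sup_def)
  with A sets show "\<exists>A\<in>sets borel. 0 < orbit_sup \<sigma> \<mu> A \<and> orbit_sup \<sigma> \<mu> A < e"
    by (intro bexI[of _ A]) auto
qed

text \<open>Single points are null, so each centre has a small ball; compactness makes the radius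
  uniform, as for a Lebesgue number. Uniformity matters because an isometry moves the centre of a
  ball and keeps its radius.\<close>

lemma non_atomic_uniformly_small_balls:
  fixes d :: "'x::topological_space \<Rightarrow> 'x \<Rightarrow> real"
  assumes comp: "compact (UNIV :: 'x set)"
    and metric: "Metric_space UNIV d" and top: "Metric_space.mtopology UNIV d = euclidean"
    and sets: "sets \<mu> = sets borel" and prob: "prob_space \<mu>" and na: "non_atomic \<mu>" and e: "0 < e"
  obtains r where "0 < r" "\<And>x. measure \<mu> (Metric_space.mball UNIV d x r) < e"
proof -
  interpret prob_space \<mu> by (rule prob)
  interpret D: Metric_space UNIV d by (rule metric)
  have open_ball: "open (D.mball x r)" for x r using D.openin_mball[of x r] by (simp add: top)
  have "\<exists>r>0. measure \<mu> (D.mball x r) < e" for x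
  proof -
    define A where "A n = D.mball x (1 / Suc n)" for n
    have A: "A n \<in> sets \<mu>" for n using open_ball sets by (simp add: A_def)
    have "y = x" if y: "\<And>n. y \<in> A n" for y
    proof (rule ccontr)
      assume "y \<noteq> x"
      then have "0 < d x y" using D.nonneg[of x y] D.zero[of x y] by force
      then obtain n where "1 / real (Suc n) < d x y" by (metis inverse_eq_divide reals_Archimedean)
      with y[of n] show False by (simp add: A_def)
    qed
    then have Inter: "(\<Inter>n. A n) = {x}" by (auto simp: A_def)
    have x: "{x} \<in> sets \<mu>" unfolding Inter[symmetric] using A by blast
    have "1 / real (Suc (Suc n)) \<le> 1 / real (Suc n)" for n by (simp add: field_simps)
    then have "decseq A" unfolding decseq_Suc_iff A_def by (intro allI D.mball_subset_concentric)
    then have "(\<lambda>n. measure \<mu> (A n)) \<longlonglongrightarrow> measure \<mu> {x}"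
      using finite_Lim_measure_decseq[of A] A Inter by auto
    moreover have "measure \<mu> {x} = 0"
    proof (rule ccontr)
      assume "measure \<mu> {x} \<noteq> 0"
      then have "0 < emeasure \<mu> {x}" by (simp add: emeasure_eq_measure zero_less_measure_iff)
      moreover have "emeasure \<mu> B = 0 \<or> emeasure \<mu> B = emeasure \<mu> {x}" if "B \<subseteq> {x}" for B
        using that by (auto simp: subset_singleton_iff)
      ultimately show False using na x unfolding non_atomic_def by blast
    qed
    ultimately have "\<forall>\<^sub>F n in sequentially. measure \<mu> (A n) < e"
      using e by (simp add: order_tendstoD(2))
    then obtain n where "measure \<mu> (A n) < e" using eventually_happens'[OF sequentially_bot] by blast
    then show ?thesis unfolding A_def by (intro exI[of _ "1 / real (Suc n)"]) simp
  qed
  then obtain \<rho> where \<rho>: "\<And>x. 0 < \<rho> x" "\<And>x. measure \<mu> (D.mball x (\<rho> x)) < e" by metis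
  obtain F where F: "finite F" "UNIV \<subseteq> (\<Union>x\<in>F. D.mball x (\<rho> x / 2))"
  proof (rule compactE_image[OF comp, of UNIV "\<lambda>x. D.mball x (\<rho> x / 2)"])
    show "UNIV \<subseteq> (\<Union>x\<in>UNIV. D.mball x (\<rho> x / 2))" using \<rho>(1) by auto
  qed (use open_ball in auto)
  \<comment> \<open>The cover uses half radii, so a ball of radius r lies in the full ball about a
    covering centre; the inserted 1 keeps the argument of \<open>Min\<close> nonempty.\<close>
  define r where "r = Min (insert 1 ((\<lambda>x. \<rho> x / 2) ` F))"
  have "0 < r" using F(1) \<rho>(1) by (simp add: r_def)
  moreover have "measure \<mu> (D.mball y r) < e" for y
  proof -
    obtain x where x: "x \<in> F" "d x y < \<rho> x / 2" using F(2) by fastforce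
    have "r \<le> \<rho> x / 2" unfolding r_def using F(1) x(1) by (intro Min_le) auto
    have "D.mball y r \<subseteq> D.mball x (\<rho> x)"
    proof
      fix z assume "z \<in> D.mball y r"
      then have "d y z < r" by simp
      with \<open>r \<le> \<rho> x / 2\<close> x(2) D.triangle[of x y z] show "z \<in> D.mball x (\<rho> x)" by simp
    qed
    then have "measure \<mu> (D.mball y r) \<le> measure \<mu> (D.mball x (\<rho> x))"
      using open_ball sets by (intro finite_measure_mono) auto
    with \<rho>(2)[of x] show ?thesis by simp
  qed
  ultimately show ?thesis by (rule that)
qed

lemma preserves_compatible_metric_small_translates:
  fixes \<sigma> :: "'x::topological_space \<Rightarrow> 'x"
  assumes comp: "compact (UNIV :: 'x set)"
    and sets: "sets \<mu> = sets borel" and prob: "prob_space \<mu>"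
    and homeo: "homeomorphism UNIV UNIV \<sigma> (inv \<sigma>)"
    and na: "non_atomic \<mu>" and pres: "preserves_compatible_metric \<sigma>"
  shows "small_translates \<sigma> \<mu>"
  unfolding small_translates_iff
proof (intro allI impI)
  fix e :: real assume e: "0 < e"
  interpret prob_space \<mu> by (rule prob)
  obtain d where metric: "Metric_space UNIV d" and top: "Metric_space.mtopology UNIV d = (euclidean :: 'x topology)"
    and iso: "\<And>x y. d (\<sigma> x) (\<sigma> y) = d x y"
    using pres unfolding preserves_compatible_metric_def by blast
  interpret D: Metric_space UNIV d by (rule metric)
  have open_ball: "open (D.mball x r)" for x r using D.openin_mball[of x r] by (simp add: top)
  have bij: "bij \<sigma>" using homeo by (rule homeomorphism_inv_bij)
  \<comment> \<open>Half of e, because a supremum of numbers below e is only known to be \<le>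
    e.\<close>
  obtain r where r: "0 < r" "\<And>x. measure \<mu> (D.mball x r) < e / 2"
    using non_atomic_uniformly_small_balls[OF comp metric top sets prob na, of "e / 2"] e by auto
  obtain F where F: "finite F" "UNIV \<subseteq> (\<Union>x\<in>F. D.mball x r)"
  proof (rule compactE_image[OF comp, of UNIV "\<lambda>x. D.mball x r"])
    show "UNIV \<subseteq> (\<Union>x\<in>UNIV. D.mball x r)" using r(1) by auto
  qed (use open_ball in auto)
  have "measure \<mu> (\<Union>x\<in>F. D.mball x r) \<le> (\<Sum>x\<in>F. measure \<mu> (D.mball x r))"
    using F(1) open_ball sets by (intro finite_measure_subadditive_finite) auto
  moreover have "(\<Union>x\<in>F. D.mball x r) = space \<mu>"
    using F(2) sets_eq_imp_space_eq[OF sets] by auto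
  ultimately have "0 < (\<Sum>x\<in>F. measure \<mu> (D.mball x r))" using prob_space by simp
  \<comment> \<open>Finitely many balls cover a space of measure 1, so one of them is not
    null.\<close>
  then have "\<exists>x\<in>F. measure \<mu> (D.mball x r) \<noteq> 0" by (metis less_irrefl sum.neutral)
  then obtain x where x: "0 < measure \<mu> (D.mball x r)" by (auto simp: zero_less_measure_iff)
  have zpow_iso: "d (zpow \<sigma> k y) (zpow \<sigma> k z) = d y z" for k y z
  proof (induction k rule: int_induct[where k = 0])
    case (step1 i)
    then show ?case by (simp add: zpow_add_one[OF bij] iso)
  next
    case (step2 i)
    have "d (zpow \<sigma> (i - 1) y) (zpow \<sigma> (i - 1) z) = d (zpow \<sigma> i y) (zpow \<sigma> i z)"
      using zpow_add_one[OF bij, of "i - 1"] iso[of "zpow \<sigma> (i - 1) y" "zpow \<sigma> (i - 1) z"] by simp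
    with step2 show ?case by simp
  qed simp
  have "measure \<mu> (zpow \<sigma> k ` D.mball x r) \<le> e / 2" for k
  proof -
    have "zpow \<sigma> k ` D.mball x r \<subseteq> D.mball (zpow \<sigma> k x) r" by (auto simp: zpow_iso)
    then have "measure \<mu> (zpow \<sigma> k ` D.mball x r) \<le> measure \<mu> (D.mball (zpow \<sigma> k x) r)"
      using open_ball sets by (intro finite_measure_mono) auto
    with r(2)[of "zpow \<sigma> k x"] show ?thesis by simp
  qed
  then have "orbit_sup \<sigma> \<mu> (D.mball x r) \<le> e / 2" by (rule orbit_sup_least)
  moreover have "0 < orbit_sup \<sigma> \<mu> (D.mball x r)"
    using x measure_le_orbit_sup[of "D.mball x r" \<sigma>] by linarith
  ultimately show "\<exists>A\<in>sets borel. 0 < orbit_sup \<sigma> \<mu> A \<and> orbit_sup \<sigma> \<mu> A < e"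
    using open_ball[of x r] e by (intro bexI[of _ "D.mball x r"]) auto
qed

section \<open>The invariant subspace\<close>

lemma L2_fun_cmult: "\<xi> \<in> L2_fun \<mu> \<Longrightarrow> (\<lambda>x. c * \<xi> x) \<in> L2_fun \<mu>"
  by (auto simp: L2_fun_def norm_mult power_mult_distrib)

lemma L2_fun_add:
  assumes "\<xi> \<in> L2_fun \<mu>" "\<eta> \<in> L2_fun \<mu>"
  shows "(\<lambda>x. \<xi> x + \<eta> x) \<in> L2_fun \<mu>"
proof -
  have "(cmod (\<xi> x + \<eta> x))\<^sup>2 \<le> 2 * (cmod (\<xi> x))\<^sup>2 + 2 * (cmod (\<eta> x))\<^sup>2" for x
  proof -
    have "(cmod (\<xi> x + \<eta> x))\<^sup>2 \<le> (cmod (\<xi> x) + cmod (\<eta> x))\<^sup>2"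
      by (intro power_mono norm_triangle_ineq) simp
    also have "\<dots> \<le> 2 * (cmod (\<xi> x))\<^sup>2 + 2 * (cmod (\<eta> x))\<^sup>2"
      using zero_le_power2[of "cmod (\<xi> x) - cmod (\<eta> x)"] by (simp add: power2_eq_square algebra_simps)
    finally show ?thesis .
  qed
  moreover have "integrable \<mu> (\<lambda>x. 2 * (cmod (\<xi> x))\<^sup>2 + 2 * (cmod (\<eta> x))\<^sup>2)"
    using assms by (auto simp: L2_fun_def)
  ultimately have "integrable \<mu> (\<lambda>x. (cmod (\<xi> x + \<eta> x))\<^sup>2)"
    using assms by (elim Bochner_Integration.integrable_bound) (auto simp: L2_fun_def)
  then show ?thesis using assms by (auto simp: L2_fun_def)
qed

lemma L2_fun_bounded_mult:
  assumes "\<xi> \<in> L2_fun \<mu>" "f \<in> borel_measurable \<mu>" "\<And>x. cmod (f x) \<le> c"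
  shows "(\<lambda>x. f x * \<xi> x) \<in> L2_fun \<mu>"
proof -
  have "integrable \<mu> (\<lambda>x. c\<^sup>2 * (cmod (\<xi> x))\<^sup>2)" using assms(1) by (auto simp: L2_fun_def)
  moreover have "(cmod (f x * \<xi> x))\<^sup>2 \<le> c\<^sup>2 * (cmod (\<xi> x))\<^sup>2" for x
    using assms(3)[of x] by (simp add: norm_mult power_mult_distrib mult_right_mono power_mono)
  ultimately have "integrable \<mu> (\<lambda>x. (cmod (f x * \<xi> x))\<^sup>2)"
    using assms(1,2) by (elim Bochner_Integration.integrable_bound) (auto simp: L2_fun_def)
  then show ?thesis using assms by (auto simp: L2_fun_def)
qed

lemma (in finite_measure) L2_fun_bounded:
  assumes "f \<in> borel_measurable M" "\<And>x. cmod (f x) \<le> c"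
  shows "f \<in> L2_fun M"
  using L2_fun_bounded_mult[OF _ assms, of "\<lambda>_. 1"] by (simp add: L2_fun_def)

lemma L2_space_cinner:
  "L2_space \<mu> cls \<Longrightarrow> \<xi> \<in> L2_fun \<mu> \<Longrightarrow> \<eta> \<in> L2_fun \<mu> \<Longrightarrow>
    cinner (cls \<xi>) (cls \<eta>) = (\<integral>x. \<xi> x * cnj (\<eta> x) \<partial>\<mu>)"
  by (simp add: L2_space_def)

lemma L2_space_norm:
  assumes "L2_space \<mu> cls" "\<xi> \<in> L2_fun \<mu>"
  shows "(norm (cls \<xi>))\<^sup>2 = (\<integral>x. (cmod (\<xi> x))\<^sup>2 \<partial>\<mu>)"
proof -
  have "cinner (cls \<xi>) (cls \<xi>) = (\<integral>x. complex_of_real ((cmod (\<xi> x))\<^sup>2) \<partial>\<mu>)"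
    using L2_space_cinner[OF assms(1) assms(2) assms(2)] by (simp only: complex_norm_square)
  then show ?thesis by (simp only: integral_complex_of_real Re_cinner_self[symmetric] Re_complex_of_real)
qed

text \<open>\<open>mult_op\<close> acts on the representative picked by \<open>inv_into\<close>,
  which is tied to a prescribed function only almost everywhere.\<close>

lemma L2_space_eq_AE:
  assumes L2: "L2_space \<mu> cls" and \<xi>: "\<xi> \<in> L2_fun \<mu>" and \<eta>: "\<eta> \<in> L2_fun \<mu>" and eq: "cls \<xi> = cls \<eta>"
  shows "AE x in \<mu>. \<xi> x = \<eta> x"
proof -
  have m: "(\<lambda>x. (-1) * \<eta> x) \<in> L2_fun \<mu>" by (rule L2_fun_cmult[OF \<eta>])
  have "cls (\<lambda>x. (-1) * \<eta> x) = scaleC (-1) (cls \<eta>)" using L2 \<eta> unfolding L2_space_def by blast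
  also have "\<dots> = - cls \<eta>" using scaleC_of_real[of "-1" "cls \<eta>"] by simp
  finally have "cls (\<lambda>x. \<xi> x + (-1) * \<eta> x) = 0"
    using L2 \<xi> m eq unfolding L2_space_def by force
  then have "(\<integral>x. (cmod (\<xi> x + (-1) * \<eta> x))\<^sup>2 \<partial>\<mu>) = 0"
    using L2_space_norm[OF L2 L2_fun_add[OF \<xi> m]] by simp
  moreover have "integrable \<mu> (\<lambda>x. (cmod (\<xi> x + (-1) * \<eta> x))\<^sup>2)"
    using L2_fun_add[OF \<xi> m] by (simp add: L2_fun_def)
  ultimately have "AE x in \<mu>. (cmod (\<xi> x + (-1) * \<eta> x))\<^sup>2 = 0"
    by (subst (asm) integral_nonneg_eq_0_iff_AE) auto
  then show ?thesis by eventually_elim simp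
qed

lemma L2_space_representative:
  assumes "L2_space \<mu> cls"
  shows "inv_into (L2_fun \<mu>) cls v \<in> L2_fun \<mu>" "cls (inv_into (L2_fun \<mu>) cls v) = v"
  using assms inv_into_into[of v cls "L2_fun \<mu>"] f_inv_into_f[of v cls "L2_fun \<mu>"]
  by (simp_all add: L2_space_def)

lemma tensor_norm:
  assumes "hilbert_tensor tens"
  shows "norm (tens \<xi> h) = norm \<xi> * norm h"
proof -
  have "(norm (tens \<xi> h))\<^sup>2 = Re (cinner \<xi> \<xi> * cinner h h)"
    using assms by (simp add: hilbert_tensor_def Re_cinner_self[symmetric])
  then have "(norm (tens \<xi> h))\<^sup>2 = (norm \<xi> * norm h)\<^sup>2"
    by (simp add: Re_cinner_self Im_cinner_self power_mult_distrib)
  then show ?thesis by simp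
qed

context enveloping_rep
begin

text \<open>C may depend on x but not on K. Using \<open>orbit_sup\<close> in place of the measure
  puts the same bound on K and on all its translates.\<close>

definition cut_dominated :: "'x measure \<Rightarrow> 'k set" where
  "cut_dominated \<mu> =
    {x. \<exists>C\<ge>0. \<forall>K. closed K \<longrightarrow> cut_norm K x \<le> C * sqrt (orbit_sup \<sigma> \<mu> K)}"

lemma csubspace_cut_dominated:
  assumes "prob_space \<mu>"
  shows "csubspace (cut_dominated \<mu>)"
  unfolding csubspace_def
proof (intro conjI ballI allI)
  interpret prob_space \<mu> by (rule assms)
  have "cut_norm K 0 \<le> 0" for K using cut_norm_le_norm[of K 0] by simp
  then show "0 \<in> cut_dominated \<mu>" unfolding cut_dominated_def by (auto intro!: exI[of _ 0])
next
  fix x y assume "x \<in> cut_dominated \<mu>" "y \<in> cut_dominated \<mu>"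
  then obtain C D where "C \<ge> 0" "D \<ge> 0"
    "\<And>K. closed K \<Longrightarrow> cut_norm K x \<le> C * sqrt (orbit_sup \<sigma> \<mu> K)"
    "\<And>K. closed K \<Longrightarrow> cut_norm K y \<le> D * sqrt (orbit_sup \<sigma> \<mu> K)"
    unfolding cut_dominated_def by blast
  then have "C + D \<ge> 0 \<and> (\<forall>K. closed K \<longrightarrow> cut_norm K (x + y) \<le> (C + D) * sqrt (orbit_sup \<sigma> \<mu> K))"
    by (auto simp: distrib_right intro: order_trans[OF cut_norm_add add_mono])
  then show "x + y \<in> cut_dominated \<mu>" unfolding cut_dominated_def by blast
next
  fix c x assume "x \<in> cut_dominated \<mu>"
  then obtain C where "C \<ge> 0" "\<And>K. closed K \<Longrightarrow> cut_norm K x \<le> C * sqrt (orbit_sup \<sigma> \<mu> K)"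
    unfolding cut_dominated_def by blast
  then have "cmod c * C \<ge> 0 \<and>
      (\<forall>K. closed K \<longrightarrow> cut_norm K (scaleC c x) \<le> (cmod c * C) * sqrt (orbit_sup \<sigma> \<mu> K))"
    by (auto simp: mult.assoc intro!: order_trans[OF cut_norm_scaleC mult_left_mono])
  then show "scaleC c x \<in> cut_dominated \<mu>" unfolding cut_dominated_def by blast
qed

text \<open>Homeomorphisms keep K closed and translation keeps \<open>orbit_sup\<close>, so all U n
  x obey the bound of x with the same C, as \<open>cut_norm_rep_le\<close> requires.\<close>

lemma cut_dominated_invariant:
  assumes "prob_space \<mu>" and a: "a \<in> ell1" and x: "x \<in> cut_dominated \<mu>"
  shows "\<pi> (\<iota> a) x \<in> cut_dominated \<mu>"
proof -
  interpret prob_space \<mu> by fact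
  obtain C where C: "C \<ge> 0" "\<And>K. closed K \<Longrightarrow> cut_norm K x \<le> C * sqrt (orbit_sup \<sigma> \<mu> K)"
    using x unfolding cut_dominated_def by blast
  have "cut_norm K (\<pi> (\<iota> a) x) \<le> l1_norm a * (C * sqrt (orbit_sup \<sigma> \<mu> K))" if K: "closed K" for K
  proof (rule cut_norm_rep_le[OF a])
    fix n
    have "cut_norm K (U n x) \<le> cut_norm (zpow \<sigma> (- n) ` K) x" by (rule cut_norm_U)
    also have "\<dots> \<le> C * sqrt (orbit_sup \<sigma> \<mu> (zpow \<sigma> (- n) ` K))"
      by (intro C(2) zpow_image_closed[OF homeo K])
    finally show "cut_norm K (U n x) \<le> C * sqrt (orbit_sup \<sigma> \<mu> K)"
      by (simp add: orbit_sup_zpow[OF bij_\<sigma>])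
    show "0 \<le> C * sqrt (orbit_sup \<sigma> \<mu> K)"
      using C(1) order_trans[OF measure_nonneg measure_le_orbit_sup[of K \<sigma>]] by simp
  qed
  moreover have "0 \<le> l1_norm a" unfolding l1_norm_def by (rule infsum_nonneg) auto
  ultimately show ?thesis using C(1) unfolding cut_dominated_def
    by (auto intro!: exI[of _ "l1_norm a * C"] simp: mult.assoc)
qed

text \<open>The powers of 1 / (1 + g), with g vanishing exactly on K, are cut-offs decreasing to the
  indicator of K; dominated convergence gives the bound sqrt (measure K) * norm h.\<close>

lemma tensor_one_in_cut_dominated:
  fixes cls :: "('x \<Rightarrow> complex) \<Rightarrow> 'l::hilbert_space" and tens :: "'l \<Rightarrow> 'h::hilbert_space \<Rightarrow> 'k"
  assumes metr: "metrizable_space (euclidean :: 'x topology)"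
    and sets: "sets \<mu> = sets borel" and prob: "prob_space \<mu>"
    and L2: "L2_space \<mu> cls" and tensor: "hilbert_tensor tens"
    and CX: "\<And>f. is_tensor_op tens (mult_op \<mu> cls (apply_bcontfun f)) id (M f)"
  shows "tens (cls (\<lambda>_. 1)) h \<in> cut_dominated \<mu>"
proof -
  interpret prob_space \<mu> by (rule prob)
  have meas: "f \<in> borel_measurable \<mu>" if "continuous_on UNIV f" for f :: "'x \<Rightarrow> 'b::topological_space"
    using borel_measurable_continuous_onI[OF that] measurable_cong_sets[OF sets refl] by blast
  have one: "(\<lambda>_. 1) \<in> L2_fun \<mu>" by (rule L2_fun_bounded[where c = 1]) auto
  define \<gamma> where "\<gamma> = inv_into (L2_fun \<mu>) cls (cls (\<lambda>_. 1))"
  have \<gamma>: "\<gamma> \<in> L2_fun \<mu>" "cls \<gamma> = cls (\<lambda>_. 1)"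
    using L2_space_representative[OF L2] by (simp_all add: \<gamma>_def)
  have \<gamma>1: "AE x in \<mu>. \<gamma> x = 1" by (rule L2_space_eq_AE[OF L2 \<gamma>(1) one \<gamma>(2)])
  have norm_M: "norm (M f (tens (cls (\<lambda>_. 1)) h)) = sqrt (\<integral>x. (cmod (f x))\<^sup>2 \<partial>\<mu>) * norm h" for f
  proof -
    have fm: "apply_bcontfun f \<in> borel_measurable \<mu>" by (rule meas) simp
    have "(\<lambda>x. f x * \<gamma> x) \<in> L2_fun \<mu>"
      by (rule L2_fun_bounded_mult[OF \<gamma>(1) fm norm_bounded])
    then have "(norm (mult_op \<mu> cls f (cls (\<lambda>_. 1))))\<^sup>2 = (\<integral>x. (cmod (f x * \<gamma> x))\<^sup>2 \<partial>\<mu>)"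
      by (simp add: mult_op_def L2_lift_def \<gamma>_def[symmetric] L2_space_norm[OF L2])
    also have "\<dots> = (\<integral>x. (cmod (f x))\<^sup>2 \<partial>\<mu>)"
      using \<gamma>1 fm \<gamma>(1) by (intro integral_cong_AE) (auto simp: L2_fun_def)
    finally have "norm (mult_op \<mu> cls f (cls (\<lambda>_. 1))) = sqrt (\<integral>x. (cmod (f x))\<^sup>2 \<partial>\<mu>)"
      by (metis norm_ge_zero real_sqrt_unique)
    then show ?thesis using CX[of f] by (simp add: is_tensor_op_def tensor_norm[OF tensor])
  qed
  have "cut_norm K (tens (cls (\<lambda>_. 1)) h) \<le> norm h * sqrt (orbit_sup \<sigma> \<mu> K)" if K: "closed K" for K
  proof -
    obtain g :: "'x \<Rightarrow> real" where g: "continuous_on UNIV g" "\<And>x. 0 \<le> g x" "\<And>x. g x = 0 \<longleftrightarrow> x \<in> K"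
      using closed_zero_set[OF metr K] by blast
    define f where "f n x = complex_of_real ((1 / (1 + g x)) ^ n)" for n x
    have nz: "1 + g x \<noteq> 0" for x using g(2)[of x] by linarith
    have le: "1 / (1 + g x) \<le> 1" "0 \<le> 1 / (1 + g x)" for x using g(2)[of x] by simp_all
    have norm_f: "cmod (f n x) = (1 / (1 + g x)) ^ n" for n x
      unfolding f_def norm_of_real using le(2)[of x] by simp
    have norm_f_le: "cmod (f n x) \<le> 1" for n x
      unfolding norm_f by (rule power_le_one[OF le(2) le(1)])
    have cont: "continuous_on UNIV (f n)" for n
      unfolding f_def using g(1) nz by (intro continuous_intros) auto
    have "f n \<in> bcontfun" for n
      using cont norm_f_le by (auto simp: bcontfun_def bounded_iff)
    then have app: "apply_bcontfun (Bcontfun (f n)) = f n" for n by (simp add: Bcontfun_inverse)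
    have cut: "Bcontfun (f n) \<in> cutoff K" for n
      unfolding cutoff_def mem_Collect_eq
    proof
      show "norm (Bcontfun (f n)) \<le> 1" by (rule norm_bound) (simp add: app norm_f_le)
      show "\<forall>x\<in>K. Bcontfun (f n) x = 1" by (simp add: app f_def g(3)[THEN iffD2])
    qed
    have "(\<lambda>n. \<integral>x. (cmod (f n x))\<^sup>2 \<partial>\<mu>) \<longlonglongrightarrow> (\<integral>x. indicator K x \<partial>\<mu>)"
    proof (rule integral_dominated_convergence[where w = "\<lambda>_. 1"])
      show "indicator K \<in> borel_measurable \<mu>" using K sets by (intro borel_measurable_indicator) simp
      show "(\<lambda>x. (cmod (f n x))\<^sup>2) \<in> borel_measurable \<mu>" for n
        using meas[OF cont[of n]] by simp
      show "AE x in \<mu>. (\<lambda>n. (cmod (f n x))\<^sup>2) \<longlonglongrightarrow> indicator K x"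
      proof (rule AE_I2)
        fix x
        have eq: "(cmod (f n x))\<^sup>2 = ((1 / (1 + g x))\<^sup>2) ^ n" for n
          unfolding norm_f by (simp add: power_mult[symmetric] mult.commute)
        show "(\<lambda>n. (cmod (f n x))\<^sup>2) \<longlonglongrightarrow> indicator K x"
        proof (cases "x \<in> K")
          case True
          then show ?thesis using g(3)[of x] by (simp add: eq)
        next
          case False
          then have "0 < g x" using g(2)[of x] g(3)[of x] by fastforce
          then have "(1 / (1 + g x))\<^sup>2 < 1" by (intro power_less_one_iff[THEN iffD2]) auto
          with False show ?thesis unfolding eq by (simp add: LIMSEQ_realpow_zero)
        qed
      qed
      show "AE x in \<mu>. norm ((cmod (f n x))\<^sup>2) \<le> 1" for n
        using norm_f_le by (auto simp: power_le_one)
    qed simp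
    then have "(\<lambda>n. sqrt (\<integral>x. (cmod (f n x))\<^sup>2 \<partial>\<mu>) * norm h) \<longlonglongrightarrow> sqrt (measure \<mu> K) * norm h"
      using K sets by (intro tendsto_intros) simp
    moreover have "cut_norm K (tens (cls (\<lambda>_. 1)) h) \<le> sqrt (\<integral>x. (cmod (f n x))\<^sup>2 \<partial>\<mu>) * norm h" for n
      using cut_norm_le[OF cut[of n], of "tens (cls (\<lambda>_. 1)) h"] by (simp add: norm_M app)
    ultimately have "cut_norm K (tens (cls (\<lambda>_. 1)) h) \<le> sqrt (measure \<mu> K) * norm h"
      by (intro LIMSEQ_le_const) auto
    also have "\<dots> \<le> sqrt (orbit_sup \<sigma> \<mu> K) * norm h"
      by (intro mult_right_mono real_sqrt_le_mono measure_le_orbit_sup) simp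
    finally show ?thesis by (simp add: mult.commute)
  qed
  then show ?thesis unfolding cut_dominated_def by (auto intro!: exI[of _ "norm h"])
qed

text \<open>The vector is \<open>\<Sum>\<^sub>j 2\<^sup>-\<^sup>j \<chi>\<^sub>K\<^sub>j / \<mu>(K\<^sub>j)\<^sup>1\<^sup>/\<^sup>2 \<otimes> h\<close> with \<open>sup\<^sub>k \<mu>(\<sigma>\<^sup>k(K\<^sub>j)) < 16\<^sup>-\<^sup>j\<close>: as all terms are
  nonnegative functions, its component over \<open>K\<^sub>j\<close> has norm at least \<open>2\<^sup>-\<^sup>j \<parallel>h\<parallel>\<close>.\<close>

lemma cut_dominated_ne_UNIV:
  fixes cls :: "('x \<Rightarrow> complex) \<Rightarrow> 'l::hilbert_space" and tens :: "'l \<Rightarrow> 'h::hilbert_space \<Rightarrow> 'k"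
  assumes metr: "metrizable_space (euclidean :: 'x topology)"
    and sets: "sets \<mu> = sets borel" and prob: "prob_space \<mu>"
    and L2: "L2_space \<mu> cls" and tensor: "hilbert_tensor tens"
    and CX: "\<And>f. is_tensor_op tens (mult_op \<mu> cls (apply_bcontfun f)) id (M f)"
    and small: "small_translates \<sigma> \<mu>" and h: "h \<noteq> (0 :: 'h)"
  shows "cut_dominated \<mu> \<noteq> UNIV"
proof
  interpret prob_space \<mu> by (rule prob)
  assume UNIV: "cut_dominated \<mu> = UNIV"
  \<comment> \<open>After the square root, 16^-j becomes 4^-j, and C * 4^-j eventually falls below
    any positive multiple of the weight 2^-j.\<close>
  have "\<exists>K. closed K \<and> 0 < measure \<mu> K \<and> orbit_sup \<sigma> \<mu> K < (1/16) ^ j" for j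
    using small_translates_closed[OF metr sets prob homeo small, of "(1/16) ^ j"] by force
  then obtain K where K: "\<And>j. closed (K j)" "\<And>j. 0 < measure \<mu> (K j)"
    "\<And>j. orbit_sup \<sigma> \<mu> (K j) < (1/16) ^ j"
    by metis
  define \<psi> where "\<psi> j x = complex_of_real (indicator (K j) x / sqrt (measure \<mu> (K j)))" for j x
  have \<psi>_meas: "\<psi> j \<in> borel_measurable \<mu>" for j
  proof -
    have [measurable]: "K j \<in> sets \<mu>" using K(1) sets by simp
    show ?thesis unfolding \<psi>_def by measurable
  qed
  have \<psi>: "\<psi> j \<in> L2_fun \<mu>" for j
    using \<psi>_meas
    by (rule L2_fun_bounded[where c = "1 / sqrt (measure \<mu> (K j))"])
       (auto simp: \<psi>_def norm_divide divide_right_mono split: split_indicator)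
  have cinner_\<psi>: "Re (cinner (cls (\<psi> i)) (cls (\<psi> j))) = (\<integral>x. Re (\<psi> i x) * Re (\<psi> j x) \<partial>\<mu>)" for i j
  proof -
    have "cinner (cls (\<psi> i)) (cls (\<psi> j)) = (\<integral>x. complex_of_real (Re (\<psi> i x) * Re (\<psi> j x)) \<partial>\<mu>)"
      by (simp add: L2_space_cinner[OF L2 \<psi> \<psi>] \<psi>_def)
    then show ?thesis by (simp only: integral_complex_of_real Re_complex_of_real)
  qed
  have nonneg: "0 \<le> Re (cinner (cls (\<psi> i)) (cls (\<psi> j)))" for i j
    unfolding cinner_\<psi> by (intro integral_nonneg_AE) (auto simp: \<psi>_def)
  have one: "Re (cinner (cls (\<psi> j)) (cls (\<psi> j))) = 1" for j
  proof -
    have "Re (\<psi> j x) * Re (\<psi> j x) = indicator (K j) x / measure \<mu> (K j)" for x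
      using K(2)[of j] by (auto simp: \<psi>_def split: split_indicator)
    then show ?thesis unfolding cinner_\<psi> using K(1,2)[of j] sets by simp
  qed
  then have norm_\<psi>: "norm (cls (\<psi> j)) = 1" for j
    by (simp add: norm_eq_sqrt_cinner)
  have "summable (\<lambda>j. norm ((1/2) ^ j *\<^sub>R cls (\<psi> j)))"
    by (simp add: norm_\<psi> summable_geometric)
  then have summ: "summable (\<lambda>j. (1/2) ^ j *\<^sub>R cls (\<psi> j))" by (rule summable_norm_cancel)
  define v where "v = (\<Sum>j. (1/2) ^ j *\<^sub>R cls (\<psi> j))"
  have v_\<psi>: "(1/2) ^ j \<le> Re (cinner v (cls (\<psi> j)))" for j
  proof -
    let ?t = "\<lambda>i. Re (cinner ((1/2) ^ i *\<^sub>R cls (\<psi> i)) (cls (\<psi> j)))"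
    have t: "?t i = (1/2) ^ i * Re (cinner (cls (\<psi> i)) (cls (\<psi> j)))" for i
      using linear_scale[OF bounded_linear.linear[OF bounded_linear_Re_cinner]] by simp
    have sums: "?t sums Re (cinner v (cls (\<psi> j)))"
      unfolding v_def by (rule bounded_linear.sums[OF bounded_linear_Re_cinner summable_sums[OF summ]])
    \<comment> \<open>Nonnegative inner products rule out cancellation, so the j-th term alone
      bounds the sum from below, even if the sets K j overlap.\<close>
    then have "sum ?t {j} \<le> suminf ?t"
      by (intro sum_le_suminf) (auto simp: t nonneg sums_iff)
    also have "\<dots> = Re (cinner v (cls (\<psi> j)))" using sums by (simp add: sums_iff)
    finally have "sum ?t {j} \<le> Re (cinner v (cls (\<psi> j)))" .
    then show ?thesis by (simp add: t one)
  qed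
  define \<gamma> where "\<gamma> = inv_into (L2_fun \<mu>) cls v"
  have \<gamma>: "\<gamma> \<in> L2_fun \<mu>" "cls \<gamma> = v"
    using L2_space_representative[OF L2] by (simp_all add: \<gamma>_def)
  have lower: "(1/2) ^ j * norm h \<le> cut_norm (K j) (tens v h)" for j
  proof (rule cut_norm_greatest)
    fix f assume f: "f \<in> cutoff (K j)"
    have fm: "apply_bcontfun f \<in> borel_measurable \<mu>"
      using borel_measurable_continuous_onI[OF continuous_on_apply_bcontfun[of UNIV f]]
        measurable_cong_sets[OF sets refl] by blast
    have "(\<lambda>x. f x * \<gamma> x) \<in> L2_fun \<mu>"
      by (rule L2_fun_bounded_mult[OF \<gamma>(1) fm norm_bounded])
    then have "cinner (mult_op \<mu> cls f v) (cls (\<psi> j)) = (\<integral>x. f x * \<gamma> x * cnj (\<psi> j x) \<partial>\<mu>)"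
      by (simp add: mult_op_def L2_lift_def \<gamma>_def[symmetric] L2_space_cinner[OF L2 _ \<psi>])
    \<comment> \<open>\<psi> j lives on K j, where f is 1, so pairing with it does not see the
      cut-off.\<close>
    also have "\<dots> = (\<integral>x. \<gamma> x * cnj (\<psi> j x) \<partial>\<mu>)"
      using f by (intro Bochner_Integration.integral_cong)
        (auto simp: \<psi>_def cutoff_def split: split_indicator)
    also have "\<dots> = cinner v (cls (\<psi> j))" using L2_space_cinner[OF L2 \<gamma>(1) \<psi>] \<gamma>(2) by simp
    finally have "(1/2) ^ j \<le> Re (cinner (mult_op \<mu> cls f v) (cls (\<psi> j)))" using v_\<psi>[of j] by simp
    also have "\<dots> \<le> norm (mult_op \<mu> cls f v)"
      using Re_cinner_le[of "mult_op \<mu> cls f v" "cls (\<psi> j)"] by (simp add: norm_\<psi>)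
    finally show "(1/2) ^ j * norm h \<le> norm (M f (tens v h))"
      using CX[of f] by (simp add: is_tensor_op_def tensor_norm[OF tensor] mult_right_mono)
  qed
  have "tens v h \<in> cut_dominated \<mu>" using UNIV by simp
  then obtain C where C: "C \<ge> 0"
    "\<And>L. closed L \<Longrightarrow> cut_norm L (tens v h) \<le> C * sqrt (orbit_sup \<sigma> \<mu> L)"
    unfolding cut_dominated_def by blast
  have "norm h \<le> C * (1/2) ^ j" for j
  proof -
    have "(1/2) ^ j * norm h \<le> C * sqrt (orbit_sup \<sigma> \<mu> (K j))"
      by (rule order_trans[OF lower C(2)[OF K(1)]])
    also have "\<dots> \<le> C * sqrt ((1/16) ^ j)"
      using C(1) K(3)[of j] by (intro mult_left_mono real_sqrt_le_mono) auto
    also have "sqrt ((1/16 :: real) ^ j) = (1/2) ^ j * (1/2) ^ j"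
      by (rule real_sqrt_unique) (simp_all add: power_mult_distrib[symmetric] power2_eq_square)
    finally have "(1/2) ^ j * norm h \<le> (1/2) ^ j * (C * (1/2) ^ j)" by (simp only: mult_ac)
    then show ?thesis by (rule mult_left_le_imp_le) simp
  qed
  moreover have "(\<lambda>j. C * (1/2) ^ j) \<longlonglongrightarrow> C * 0" by (intro tendsto_intros LIMSEQ_realpow_zero) auto
  ultimately have "norm h \<le> C * 0" by (intro LIMSEQ_le_const) auto
  with h show False by simp
qed

end

theorem theorem3p4:
  fixes \<sigma> :: "'x::topological_space \<Rightarrow> 'x"
    and \<mu> :: "'x measure"
    and cls :: "('x \<Rightarrow> complex) \<Rightarrow> 'l::hilbert_space"
    and tens :: "'l \<Rightarrow> 'h::hilbert_space \<Rightarrow> 'k::hilbert_space"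
    and VI W :: "'k \<Rightarrow> 'k"
    and \<iota> :: "(int \<Rightarrow> ('x \<Rightarrow>\<^sub>C complex)) \<Rightarrow> 'c::unital_cstar_algebra"
    and \<pi> :: "'c \<Rightarrow> 'k \<Rightarrow> 'k"
  assumes X_compact: "compact (UNIV :: 'x set)"
    and X_metrizable: "metrizable_space (euclidean :: 'x topology)"
    and \<sigma>_homeo: "homeomorphism UNIV UNIV \<sigma> (inv \<sigma>)"
    and \<iota>_env: "enveloping_cstar_algebra \<sigma> \<iota>"
    and \<mu>_borel: "sets \<mu> = sets borel"
    and \<mu>_prob: "prob_space \<mu>"
    and \<mu>_quasi: "quasi_invariant \<sigma> \<mu>"
    and \<mu>_ergodic: "ergodic \<sigma> \<mu>"
    and L2: "L2_space \<mu> cls"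
    and tensor: "hilbert_tensor tens"
    and VI: "is_tensor_op tens (translation_op \<sigma> \<mu> cls) id VI"
    and W_unitary: "unitary_op W"
    and W_mem: "W \<in> Linf_tensor_BH \<mu> cls tens"
    and W_fixed: "{R \<in> Linf_tensor_BH \<mu> cls tens. Ad (W \<circ> VI) R = R} = range scaleC"
    and \<pi>_rep: "star_representation \<pi>"
    and \<pi>_CX: "\<forall>f. is_tensor_op tens (mult_op \<mu> cls (apply_bcontfun f)) id (\<pi> (\<iota> (l1_single 0 f)))"
    and \<pi>_delta: "\<pi> (\<iota> (l1_delta 1)) = W \<circ> VI"
    and \<pi>_irr: "topologically_irreducible (range \<pi>)"
    and \<mu>_nonatomic: "non_atomic \<mu>"
  shows "(small_translates \<sigma> \<mu> \<longrightarrow> \<not> algebraically_irreducible ((\<lambda>a. \<pi> (\<iota> a)) ` ell1)) \<and>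
         (measure_invariant \<sigma> \<mu> \<longrightarrow> small_translates \<sigma> \<mu>) \<and>
         (preserves_compatible_metric \<sigma> \<longrightarrow> small_translates \<sigma> \<mu>)"
proof (intro conjI impI)
  show "small_translates \<sigma> \<mu>" if "measure_invariant \<sigma> \<mu>"
    by (rule measure_invariant_small_translates) fact+
  show "small_translates \<sigma> \<mu>" if "preserves_compatible_metric \<sigma>"
    by (rule preserves_compatible_metric_small_translates) fact+
  assume small: "small_translates \<sigma> \<mu>"
  interpret enveloping_rep \<sigma> \<iota> \<pi> by unfold_locales fact+
  have CX: "is_tensor_op tens (mult_op \<mu> cls (apply_bcontfun f)) id (M f)" for f
    using \<pi>_CX by (simp add: M_def)
  \<comment> \<open>If H were zero, the closed span of the elementary tensors would be zero, and
    \<open>topologically_irreducible\<close> excludes the zero space.\<close>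
  have "\<exists>h :: 'h. h \<noteq> 0"
  proof (rule ccontr)
    assume "\<not> (\<exists>h :: 'h. h \<noteq> 0)"
    then have "norm h = 0" for h :: 'h by simp
    then have "tens \<xi> h = 0" for \<xi> h using tensor_norm[OF tensor, of \<xi> h] by (metis mult_zero_right norm_eq_zero)
    then have "span {tens \<xi> h |\<xi> h. True} = {0}" by simp
    then have "(UNIV :: 'k set) = {0}" using tensor unfolding hilbert_tensor_def by (simp add: closure_closed)
    with \<pi>_irr show False by (simp add: topologically_irreducible_def)
  qed
  then obtain h :: 'h where h: "h \<noteq> 0" by blast
  have "tens (cls (\<lambda>_. 1)) h \<in> cut_dominated \<mu>"
    by (rule tensor_one_in_cut_dominated[OF X_metrizable \<mu>_borel \<mu>_prob L2 tensor CX])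
  moreover have "tens (cls (\<lambda>_. 1)) h \<noteq> 0"
  proof -
    interpret prob_space \<mu> by (rule \<mu>_prob)
    have "(\<lambda>_. 1) \<in> L2_fun \<mu>" by (simp add: L2_fun_def)
    then have "(norm (cls (\<lambda>_. 1)))\<^sup>2 = 1" using L2_space_norm[OF L2] by (simp add: prob_space)
    then have "norm (tens (cls (\<lambda>_. 1)) h) \<noteq> 0" using h by (auto simp: tensor_norm[OF tensor])
    then show ?thesis by simp
  qed
  ultimately have "cut_dominated \<mu> \<noteq> {0}" by blast
  moreover have "cut_dominated \<mu> \<noteq> UNIV"
    by (rule cut_dominated_ne_UNIV[OF X_metrizable \<mu>_borel \<mu>_prob L2 tensor CX small h])
  moreover have "\<forall>T\<in>(\<lambda>a. \<pi> (\<iota> a)) ` ell1. T ` cut_dominated \<mu> \<subseteq> cut_dominated \<mu>"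
    using cut_dominated_invariant[OF \<mu>_prob] by blast
  ultimately show "\<not> algebraically_irreducible ((\<lambda>a. \<pi> (\<iota> a)) ` ell1)"
    using csubspace_cut_dominated[OF \<mu>_prob] unfolding algebraically_irreducible_def by blast
qed

end
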